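(* Let $(X_n)_{n\ge 1}$ be a sequence of i.i.d. random vectors with the same law as $X$, and let $(\widehat\theta_n)_{n\ge1}$ be the projected Robbins-Monro sequence defined in the context, with step sequence $(\gamma_n)_{n\geq 1}$ a decreasing sequence of positive real numbers satisfying $\sum_{n\ge1}\gamma_n=\infty$ and $\sum_{n\ge1}\gamma_n^2<\infty$. Assume that [A1], [A2] and [A3] hold. Then $$\lim_{n\to\infty}\|\widehat\theta_n-\theta\|=0\quad\text{almost surely.}$$ Moreover, the number of indices $n$ for which the random vector $\widehat\theta_n-\gamma_n\nabla_y g(X_{n+1},\widehat\theta_n)$ does not belong to $\mathcal K$ is almost surely finite.
   Context: Model. Let $d\ge2$ and let $X$ be a random vector of $\mathbb R^d$ of the form $X=\mu+r\,W\,U_\Omega$, where $\mu\in\mathbb R^d$, $r>0$, $W$ is a positive real continuous random variable (with a bounded density if $d=2$), $U_\Omega$ is uniformly distributed on a measurable subset $\Omega$ (of positive surface measure) of the unit sphere of $\mathbb R^d$, and $W$ and $U_\Omega$ are independent. Set $r^\star:=r\,\mathbb E[W]$ and $\theta:=(\mu,r^\star)\in\mathbb R^d\times\mathbb R$. Norms are Euclidean, $\langle\cdot,\cdot\rangle$ is the usual inner product, $\mathcal B(x,\rho)$ is the ball of center $x$ and radius $\rho$, and $\lambda_{\max}(M)$ is the largest eigenvalue of the matrix $M$. Assumptions. [A1] $\mathbb E[\|X-\mu\|^{-2}]<\infty$. [A2] $\mathbb E[\|X-\mu\|^{2}]<\infty$. [A3] There are positive constants $R_\mu,R_r$ such that $$\sup_{z\in\overline{\mathcal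 B(\mu,R_\mu)}}\lambda_{\max}(\Gamma(z))<\frac{1-\|\mathbb E[U_\Omega]\|^2/A}{r^\star+\frac32R_r}$$ for some $A$ with $\|\mathbb E[U_\Omega]\|^2<A<1$, where $$\Gamma(z):=\mathbb E\left[\frac1{\|X-z\|}\left(I_d-\frac{(X-z)(X-z)^T}{\|X-z\|^2}\right)\right].$$ Compact set and projection. With $R_\mu,R_r$ the constants of [A3], $\mathcal K$ is a compact convex subset of $\mathbb R^d\times(0,\infty)$ contained in $\overline{\mathcal B(\mu,R_\mu)}\times\overline{\mathcal B(r^\star,R_r)}$ such that $\theta\in\mathcal K\setminus\partial\mathcal K$ ($\partial\mathcal K$ is the boundary of $\mathcal K$ in $\mathbb R^d\times\mathbb R$). The map $\pi:\mathbb R^d\times\mathbb R\to\mathcal K$ is a projection onto $\mathcal K$ satisfying: $\pi(y)=y$ for $y\in\mathcal K$; $\|\pi(y)-\pi(y')\|\le\|y-y'\|$ for all $y,y'$; and $\pi(y)\in\partial\mathcal K$ for all $y\notin\mathcal K$. Projected Robbins-Monro algorithm. For $x\in\mathbb R^d$ and $y=(z,a)\in\mathbb R^d\times(0,\infty)$ let $g(x,y):=\frac12(\|x-z\|-a)^2$, so that for $x\neq z$ $$\nabla_yg(x,y)=\begin{pmatrix}z-x-a\,\frac{z-x}{\|z-x\|}\\ a-\|z-x\|\end{pmatrix}.$$ (For each fixed $z$, $X\ne z$ almost surely.) The sequence is defined by $\widehat\theta_1$ arbitrarily chosen in $\mathcal K$ and, for $n\ge1$, $$\widehat\theta_{n+1}=\pi\left(\widehat\theta_n-\gamma_n\nabla_yg(X_{n+1},\widehat\theta_n)\right).$$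 *)

theory Defs
  imports "HOL-Probability.Probability"
begin

text \<open>
  Surface measure of the unit sphere of a Euclidean space of dimension d, by polar coordinates:
  the surface measure of B is d times the Lebesgue measure of the cone of all t u with u in B
  and 0 < t < 1. The measure lives on the Borel sets of the whole space and is carried by the
  unit sphere (the origin, which is mapped to itself, is a Lebesgue null set).
\<close>

definition sphere_measure :: "'a::euclidean_space measure" where
  "sphere_measure =
     scale_measure (of_nat DIM('a))
       (distr (restrict_space lborel (ball 0 1)) borel (\<lambda>x. (1 / norm x) *\<^sub>R x))"

text \<open>
  A continuous random variable is one with a continuous distribution function. This includes
  every random variable that has a density.
\<close>

definition truncated_spherical_model ::
  "'p measure \<Rightarrow> real ^ 'n \<Rightarrow> real \<Rightarrow> ('p \<Rightarrow> real) \<Rightarrow> (real ^ 'n) set \<Rightarrow> ('p \<Rightarrow> real ^ 'n)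
     \<Rightarrow> ('p \<Rightarrow> real ^ 'n) \<Rightarrow> bool" where
  "truncated_spherical_model M \<mu> r W S U X \<longleftrightarrow>
     r > 0 \<and>
     W \<in> borel_measurable M \<and> (AE \<omega> in M. W \<omega> > 0) \<and>
     continuous_on UNIV (cdf (distr M borel W)) \<and>
     (CARD('n) = 2 \<longrightarrow> (\<exists>f B. distributed M lborel W f \<and> (\<forall>t. f t \<le> ennreal B))) \<and>
     S \<subseteq> sphere 0 1 \<and> S \<in> sets borel \<and> emeasure sphere_measure S > 0 \<and>
     U \<in> borel_measurable M \<and> distr M borel U = uniform_measure sphere_measure S \<and>
     prob_space.indep_set M {W -` A \<inter> space M |A. A \<in> sets borel}
                            {U -` B \<inter> space M |B. B \<in> sets borel} \<and>
     X = (\<lambda>\<omega>. \<mu> + (r * W \<omega>) *\<^sub>R U \<omega>)"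

definition outer_square :: "real ^ 'n \<Rightarrow> real ^ 'n ^ 'n" where
  "outer_square v = (\<chi> i j. v $ i * v $ j)"

text \<open>Meaningful for matrices that have a real eigenvalue, in particular for symmetric ones.\<close>

definition lambda_max :: "real ^ 'n ^ 'n \<Rightarrow> real" where
  "lambda_max A = Max {l. \<exists>v. v \<noteq> 0 \<and> A *v v = l *\<^sub>R v}"

definition Gamma_mat :: "'p measure \<Rightarrow> ('p \<Rightarrow> real ^ 'n) \<Rightarrow> real ^ 'n \<Rightarrow> real ^ 'n ^ 'n" where
  "Gamma_mat M X z =
     (\<integral>\<omega>. (1 / norm (X \<omega> - z)) *\<^sub>R
            (mat 1 - (1 / (norm (X \<omega> - z))\<^sup>2) *\<^sub>R outer_square (X \<omega> - z)) \<partial>M)"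

definition g :: "'a::euclidean_space \<Rightarrow> 'a \<times> real \<Rightarrow> real" where
  "g x y = (1/2) * (norm (x - fst y) - snd y)\<^sup>2"

text \<open>
  The gradient of g in its second argument where x differs from the first component z of y.
  When they coincide, the formula evaluates to (0, a), by the convention 1 / 0 = 0.
\<close>

definition grad_g :: "'a::euclidean_space \<Rightarrow> 'a \<times> real \<Rightarrow> 'a \<times> real" where
  "grad_g x y = (case y of (z, a) \<Rightarrow>
     (z - x - (a / norm (z - x)) *\<^sub>R (z - x), a - norm (z - x)))"

lemma grad_g_gradient:
  fixes x z :: "'a::euclidean_space"
  assumes "x \<noteq> z"
  shows "GDERIV (g x) (z, a) :> grad_g x (z, a)"
proof -
  have d: "((\<lambda>y::'a \<times> real. x - fst y) has_derivative (\<lambda>h. - fst h)) (at (z, a))"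
    by (auto intro!: derivative_eq_intros)
  have nd: "((\<lambda>y::'a \<times> real. norm (x - fst y)) has_derivative (\<lambda>h. - fst h \<bullet> sgn (x - z))) (at (z, a))"
  proof -
    have "(norm has_derivative (\<lambda>h. h \<bullet> sgn (x - z))) (at (x - fst (z, a)))"
      using assms by (simp add: has_derivative_norm)
    from has_derivative_compose[OF d this] show ?thesis by simp
  qed
  have "((\<lambda>y. (1/2) * (norm (x - fst y) - snd y)\<^sup>2) has_derivative
      (\<lambda>h. (norm (x - z) - a) * (- (sgn (x - z) \<bullet> fst h) - snd h))) (at (z, a))"
    by (auto intro!: derivative_eq_intros nd simp: fun_eq_iff inner_commute field_simps)
  moreover have "(norm (x - z) - a) * (- (sgn (x - z) \<bullet> fst h) - snd h) =
      h \<bullet> grad_g x (z, a)" for h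
  proof -
    define v where "v = z - x"
    have v: "v \<noteq> 0" "x - z = - v" "z - x = v" using assms by (auto simp: v_def)
    have "(norm v - a) * (fst h \<bullet> v / norm v - snd h) =
        fst h \<bullet> v - a / norm v * (fst h \<bullet> v) + snd h * (a - norm v)"
      using v(1) by (simp add: field_simps)
    then show ?thesis
      by (simp add: grad_g_def inner_prod_def inner_diff_right v(2,3) sgn_div_norm inner_commute
          divide_inverse mult.commute)
  qed
  ultimately show ?thesis
    by (simp add: gderiv_def g_def[abs_def])
qed

end

theory Submission
  imports Defs
begin

text \<open>
  Write \<open>\<Phi> y\<close> for the expected gradient at \<open>y = (\<mu> + h, a)\<close>. On \<open>K\<close> it is coercive:
  \<open>\<Phi> y \<bullet> (y - \<theta>) \<ge> c |y - \<theta>|\<^sup>2\<close>. Indeed \<open>F z = E |X - z|\<close> satisfies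
  \<open>\<nabla>F \<mu> = - E U\<close>, so that with \<open>b = a - r\<^sup>*\<close> the inner product equals
  \<open>|h|\<^sup>2 + b\<^sup>2 + 2 b (E U \<bullet> h)\<close> minus \<open>a (\<nabla>F (\<mu> + h) - \<nabla>F \<mu>) \<bullet> h\<close> and minus \<open>b\<close> times the
  second-order Taylor remainder of \<open>F\<close>. Both subtracted terms are integrals of
  \<open>h \<bullet> \<Gamma>(\<mu> + t h) h\<close> over \<open>0 \<le> t \<le> 1\<close>, hence controlled by [A3], and the cross term is
  absorbed by Young's inequality with weight \<open>A\<close>. The exchange of integrals is Tonelli's theorem
  for the nonnegative second derivative of \<open>t \<mapsto> |X - \<mu> - t h|\<close>. It needs \<open>\<Gamma>(\<mu> + t h)\<close> to be
  a convergent integral only for almost every \<open>t\<close>, and this holds because the direction \<open>U\<close>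
  falls in a slab \<open>|e \<bullet> u| \<le> s\<close> with probability \<open>O(s)\<close>.

  Consequently \<open>V\<^sub>n = |\<theta>\<^sub>n - \<theta>|\<^sup>2\<close> obeys
  \<open>E[V\<^sub>n\<^sub>+\<^sub>1 | past] \<le> (1 - 2 c \<gamma>\<^sub>n) V\<^sub>n + C \<gamma>\<^sub>n\<^sup>2\<close>, which forces \<open>E V\<^sub>n\<close> to tend to 0, and the maximal
  inequality for nonnegative supermartingales gives almost sure convergence. Each projection that
  is not the identity puts the next iterate on the frontier of \<open>K\<close>, which is at positive distance
  from \<open>\<theta>\<close>.
\<close>

subsection \<open>Rayleigh quotients and slabs of the ball\<close>

text \<open>By compactness the quadratic form attains its maximum on the unit sphere; a maximiser is
  an eigenvector and the maximum its eigenvalue. Symmetry also makes the set of eigenvalues finite,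
  which gives the \<open>Max\<close> in \<open>lambda_max\<close> its meaning.\<close>

lemma rayleigh_le_lambda_max:
  fixes A :: "real ^ 'n ^ 'n"
  assumes sym: "transpose A = A"
  shows "v \<bullet> (A *v v) \<le> lambda_max A * (v \<bullet> v)"
proof -
  have adj: "(A *v x) \<bullet> y = x \<bullet> (A *v y)" for x y
  proof -
    have "(A *v x) \<bullet> y = (transpose A *v x) \<bullet> y" by (simp only: sym)
    then show ?thesis by (simp only: transpose_matrix_vector dot_lmul_matrix)
  qed
  let ?E = "{l. \<exists>v. v \<noteq> 0 \<and> A *v v = l *\<^sub>R v}"
  \<comment> \<open>Choose one eigenvector per eigenvalue. For different eigenvalues of a symmetric
    matrix they are orthogonal, hence independent, so there are only finitely many.\<close>
  have fin: "finite ?E"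
  proof -
    define ev where "ev l = (SOME v. v \<noteq> 0 \<and> A *v v = l *\<^sub>R v)" for l
    have ev: "ev l \<noteq> 0 \<and> A *v ev l = l *\<^sub>R ev l" if "l \<in> ?E" for l
      using that unfolding ev_def mem_Collect_eq by (rule someI_ex)
    have inj: "inj_on ev ?E"
    proof (rule inj_onI)
      fix k l assume k: "k \<in> ?E" and l: "l \<in> ?E" and eq: "ev k = ev l"
      have "k *\<^sub>R ev k = l *\<^sub>R ev k" using ev[OF k] ev[OF l] eq by metis
      then show "k = l" using ev[OF k] by simp
    qed
    have "pairwise orthogonal (ev ` ?E)"
    proof (rule pairwiseI)
      fix x y assume "x \<in> ev ` ?E" "y \<in> ev ` ?E" "x \<noteq> y"
      then obtain k l where kl: "k \<in> ?E" "l \<in> ?E" "x = ev k" "y = ev l" "k \<noteq> l" by blast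
      have "k * (x \<bullet> y) = l * (x \<bullet> y)"
        using adj[of x y] ev[OF kl(1)] ev[OF kl(2)] unfolding kl(3,4) by simp
      with kl show "orthogonal x y" by (simp add: orthogonal_def)
    qed
    moreover have "0 \<notin> ev ` ?E" using ev by force
    ultimately have "independent (ev ` ?E)" by (rule pairwise_orthogonal_independent)
    then have "finite (ev ` ?E)" using independent_bound by blast
    with inj show ?thesis using finite_imageD by blast
  qed
  have "\<exists>u\<in>sphere 0 1. \<forall>y\<in>sphere (0 :: real ^ 'n) 1. y \<bullet> (A *v y) \<le> u \<bullet> (A *v u)"
    by (rule continuous_attains_sup) (auto intro!: continuous_intros)
  then obtain u where u: "norm u = 1"
    and umax: "\<And>y. norm y = 1 \<Longrightarrow> y \<bullet> (A *v y) \<le> u \<bullet> (A *v u)" by auto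
  define l where "l = u \<bullet> (A *v u)"
  have le: "y \<bullet> (A *v y) \<le> l * (y \<bullet> y)" for y
  proof (cases "y = 0")
    case False
    then have "(y /\<^sub>R norm y) \<bullet> (A *v (y /\<^sub>R norm y)) \<le> l"
      unfolding l_def by (intro umax) simp
    then have "(y \<bullet> (A *v y)) / (norm y)\<^sup>2 \<le> l"
      by (simp add: matrix_vector_mult_scaleR power2_eq_square divide_inverse algebra_simps)
    with False show ?thesis by (simp add: divide_le_eq power2_norm_eq_inner)
  qed simp
  have "A *v u = l *\<^sub>R u"
  proof -
    \<comment> \<open>\<open>w\<close> is the defect of the eigenvalue equation at the maximiser.
      Moving \<open>u\<close> by \<open>t *\<^sub>R w\<close> takes
      \<open>y \<bullet> (A *v y) - l * (y \<bullet> y)\<close> from 0 to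
      \<open>2 * t * p + t\<^sup>2 * q\<close>. As this is never positive, the first-order
      coefficient \<open>p\<close> vanishes.\<close>
    define w where "w = A *v u - l *\<^sub>R u"
    define p where "p = w \<bullet> w"
    define q where "q = w \<bullet> (A *v w) - l * p"
    have quad: "2 * t * p + t\<^sup>2 * q \<le> 0" for t
    proof -
      have "(u + t *\<^sub>R w) \<bullet> (A *v (u + t *\<^sub>R w)) - l * ((u + t *\<^sub>R w) \<bullet> (u + t *\<^sub>R w))
         = (u \<bullet> (A *v u) - l * (u \<bullet> u)) + 2 * t * (w \<bullet> (A *v u) - l * (w \<bullet> u)) + t\<^sup>2 * q"
        using adj[of w u]
        by (simp add: q_def p_def matrix_vector_right_distrib matrix_vector_mult_scaleR inner_add_left
            inner_add_right inner_commute power2_eq_square algebra_simps)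
      moreover have "u \<bullet> u = 1" using u by (simp add: norm_eq_1)
      moreover have "w \<bullet> (A *v u) - l * (w \<bullet> u) = p"
        by (simp add: p_def w_def inner_diff_right inner_diff_left algebra_simps)
      ultimately show ?thesis using le[of "u + t *\<^sub>R w"] l_def by simp
    qed
    have p0: "p \<ge> 0" by (simp add: p_def)
    have "p = 0"
    proof (rule ccontr)
      assume "p \<noteq> 0"
      with p0 have p: "p > 0" by simp
      \<comment> \<open>Small enough for \<open>t * \<bar>q\<bar> \<le> p\<close>, so that the
        linear term outweighs the quadratic one.\<close>
      define t where "t = p / (\<bar>q\<bar> + 1)"
      have t: "t > 0" using p by (simp add: t_def)
      have "t * \<bar>q\<bar> \<le> p" using p by (simp add: t_def divide_le_eq field_simps)
      moreover have "t * (- \<bar>q\<bar>) \<le> t * q" by (rule mult_left_mono) (use t in auto)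
      ultimately have "- p \<le> t * q" by simp
      then have "0 < t * (2 * p + t * q)" using p t by simp
      also have "\<dots> = 2 * t * p + t\<^sup>2 * q" by (simp add: power2_eq_square algebra_simps)
      finally show False using quad[of t] by simp
    qed
    then show ?thesis by (simp add: p_def w_def)
  qed
  moreover have "u \<noteq> 0" using u by auto
  ultimately have "l \<in> ?E" by blast
  then have "l \<le> lambda_max A" unfolding lambda_max_def using fin by (intro Max_ge) auto
  then have "l * (v \<bullet> v) \<le> lambda_max A * (v \<bullet> v)" by (rule mult_right_mono) simp
  with le[of v] show ?thesis by simp
qed

text \<open>About \<open>1/(3 s)\<close> translates of the slab along \<open>e\<close> are disjoint and contained in the ball of radius 2.\<close>
lemma emeasure_ball_slab_le:
  fixes e :: "'a::euclidean_space"
  assumes e: "norm e = 1" and s: "0 < s"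
  shows "emeasure lborel {x \<in> ball 0 1. \<bar>e \<bullet> x\<bar> \<le> s}
    \<le> ennreal (6 * s) * emeasure lborel (ball (0::'a) 2)"
proof -
  let ?S = "{x \<in> ball 0 1. \<bar>e \<bullet> x\<bar> \<le> s}"
  let ?V = "emeasure lborel (ball (0::'a) 2)"
  have S[measurable]: "?S \<in> sets borel" by measurable
  show ?thesis
  proof (cases "s \<le> 1/3")
    case False
    \<comment> \<open>Here \<open>6 * s\<close> exceeds 1, so inclusion in the larger ball is
      enough.\<close>
    have "emeasure lborel ?S \<le> ?V" by (intro emeasure_mono) auto
    also have "?V = 1 * ?V" by simp
    also have "\<dots> \<le> ennreal (6 * s) * ?V"
      using False by (intro mult_right_mono) auto
    finally show ?thesis .
  next
    case True
    \<comment> \<open>Shifts by multiples of \<open>3 * s\<close> separate slabs of width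
      \<open>2 * s\<close>, and with \<open>J\<close> of them every shift is at most 1. A number
      that is at least 1 is less than twice its integer part, whence
      \<open>1 \<le> 6 * s * real J\<close>.\<close>
    define J where "J = nat \<lfloor>1 / (3 * s)\<rfloor>"
    have J1: "real J \<le> 1 / (3 * s)" unfolding J_def using s by simp
    have "1 \<le> 1 / (3 * s)" using True s by (simp add: le_divide_eq)
    then have "0 \<le> \<lfloor>1 / (3 * s)\<rfloor>" and fl: "1 \<le> real_of_int \<lfloor>1 / (3 * s)\<rfloor>" using s by simp_all
    from this(1) have "real J = real_of_int \<lfloor>1 / (3 * s)\<rfloor>" unfolding J_def by (rule of_nat_nat)
    with fl have "1 / (3 * s) < 2 * real J" using floor_correct[of "1 / (3 * s)"] by linarith
    then have J2: "1 \<le> 6 * s * real J" using s by (simp add: field_simps)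
    define T where "T j = (\<lambda>x. x - (3 * s * real j) *\<^sub>R e) -` ?S" for j :: nat
    have T: "T j \<in> sets borel" for j
    proof -
      have "(\<lambda>x. x - (3 * s * real j) *\<^sub>R e) \<in> borel \<rightarrow>\<^sub>M borel" by measurable
      from measurable_sets[OF this S] show ?thesis by (simp add: T_def)
    qed
    have mT: "emeasure lborel (T j) = emeasure lborel ?S" for j
    proof -
      have "emeasure lborel ?S = emeasure (distr lborel borel ((+) (- ((3 * s * real j) *\<^sub>R e)))) ?S"
        by (subst lborel_distr_plus) simp
      also have "\<dots> = emeasure lborel (T j)"
        by (subst emeasure_distr) (auto simp: T_def vimage_def)
      finally show ?thesis by simp
    qed
    have disj: "disjoint_family_on T {..<J}"
      unfolding disjoint_family_on_def
    proof (intro ballI impI)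
      fix i j :: nat assume "i \<noteq> j"
      show "T i \<inter> T j = {}"
      proof (rule ccontr)
        assume "T i \<inter> T j \<noteq> {}"
        then obtain x where "\<bar>e \<bullet> (x - (3 * s * real i) *\<^sub>R e)\<bar> \<le> s" "\<bar>e \<bullet> (x - (3 * s * real j) *\<^sub>R e)\<bar> \<le> s"
          unfolding T_def by blast
        then have "\<bar>e \<bullet> x - 3 * s * real i\<bar> \<le> s" "\<bar>e \<bullet> x - 3 * s * real j\<bar> \<le> s"
          using e by (auto simp: inner_diff_right norm_eq_1)
        then have "\<bar>3 * s * real i - 3 * s * real j\<bar> \<le> 2 * s" by linarith
        then have "3 * s * \<bar>real i - real j\<bar> \<le> 2 * s"
          using s by (simp add: abs_mult flip: right_diff_distrib)
        then have "\<bar>real i - real j\<bar> < 1" using s by (simp add: field_simps)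
        with \<open>i \<noteq> j\<close> show False by linarith
      qed
    qed
    have sub: "(\<Union>j<J. T j) \<subseteq> ball 0 2"
    proof
      fix x assume "x \<in> (\<Union>j<J. T j)"
      then obtain j where j: "j < J" and x: "norm (x - (3 * s * real j) *\<^sub>R e) < 1" by (auto simp: T_def)
      have "3 * s * real j \<le> 3 * s * real J" using j s by simp
      also have "\<dots> \<le> 1" using J1 s by (simp add: field_simps)
      finally have "norm ((3 * s * real j) *\<^sub>R e) \<le> 1" using e s by simp
      with x show "x \<in> ball 0 2" using norm_triangle_sub[of x "(3 * s * real j) *\<^sub>R e"] by simp
    qed
    have "of_nat J * emeasure lborel ?S = (\<Sum>j<J. emeasure lborel (T j))" by (simp add: mT)
    also have "\<dots> = emeasure lborel (\<Union>j<J. T j)"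
      using T disj by (intro sum_emeasure) auto
    also have "\<dots> \<le> ?V" using sub by (intro emeasure_mono) auto
    finally have le: "of_nat J * emeasure lborel ?S \<le> ?V" .
    have "emeasure lborel ?S \<le> ennreal (6 * s * real J) * emeasure lborel ?S"
      using mult_right_mono[of 1 "ennreal (6 * s * real J)" "emeasure lborel ?S"] J2 by simp
    also have "\<dots> = ennreal (6 * s) * (of_nat J * emeasure lborel ?S)"
      using s by (simp add: ennreal_mult ennreal_of_nat_eq_real_of_nat mult.assoc)
    also have "\<dots> \<le> ennreal (6 * s) * ?V" by (intro mult_left_mono le) simp
    finally show ?thesis .
  qed
qed

section \<open>Integrability of an inverse square root from the measure of small values\<close>

text \<open>If |y| lies between \<open>(1/4) ^ Suc k\<close> and \<open>(1/4) ^ k\<close>, then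
  layer \<open>k\<close> alone dominates the left side. The summand 1 covers |y| > 1. At
  \<open>y = 0\<close> the left side is 0, by the convention 1 / 0 = 0.\<close>

lemma inverse_sqrt_le_layers:
  fixes y :: real
  shows "ennreal (1 / sqrt \<bar>y\<bar>) \<le> 1 + (\<Sum>k. ennreal (2 ^ Suc k) * indicator {y. \<bar>y\<bar> \<le> (1/4) ^ k} y)"
proof (cases "y = 0 \<or> \<bar>y\<bar> > 1")
  case True
  then have "1 / sqrt \<bar>y\<bar> \<le> 1" by (auto simp: divide_le_eq)
  then have "ennreal (1 / sqrt \<bar>y\<bar>) \<le> ennreal 1" by (rule ennreal_leI)
  also have "\<dots> \<le> 1 + (\<Sum>k. ennreal (2 ^ Suc k) * indicator {y. \<bar>y\<bar> \<le> (1/4) ^ k} y)" by simp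
  finally show ?thesis .
next
  case False
  then have y: "0 < \<bar>y\<bar>" "\<bar>y\<bar> \<le> 1" by auto
  have ex: "\<exists>n. (1/4::real) ^ n < \<bar>y\<bar>" using y by (intro real_arch_pow_inv) auto
  \<comment> \<open>The first power of 1/4 below |y|. It is not the zeroth since |y| is at most 1,
    so the previous power is still at least |y| and its layer contains \<open>y\<close>.\<close>
  define n where "n = (LEAST n. (1/4::real) ^ n < \<bar>y\<bar>)"
  have n: "(1/4::real) ^ n < \<bar>y\<bar>" unfolding n_def using ex by (rule LeastI_ex)
  then have "n \<noteq> 0" using y by (intro notI) simp
  then obtain k where k: "n = Suc k" by (cases n) auto
  have "\<not> (1/4::real) ^ k < \<bar>y\<bar>" using k unfolding n_def by (intro not_less_Least) simp
  then have yk: "\<bar>y\<bar> \<le> (1/4) ^ k" by simp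
  have eq: "(1/4::real) ^ n = ((1/2) ^ n)\<^sup>2" by (simp add: power2_eq_square flip: power_mult_distrib)
  have "(1/2::real) ^ n \<le> sqrt \<bar>y\<bar>" using n unfolding eq by (intro real_le_rsqrt) simp
  then have "1 / sqrt \<bar>y\<bar> \<le> 1 / (1/2) ^ n" by (intro divide_left_mono) (use y in auto)
  also have "\<dots> = 2 ^ Suc k" by (simp add: k power_divide)
  finally have "ennreal (1 / sqrt \<bar>y\<bar>) \<le> ennreal (2 ^ Suc k) * indicator {y. \<bar>y\<bar> \<le> (1/4) ^ k} y"
    using yk by (auto simp: ennreal_leI)
  also have "\<dots> \<le> (\<Sum>k. ennreal (2 ^ Suc k) * indicator {y. \<bar>y\<bar> \<le> (1/4) ^ k} y)"
    using sum_le_suminf[where f="\<lambda>k. ennreal (2 ^ Suc k) * indicator {y. \<bar>y\<bar> \<le> (1/4) ^ k} y" and I="{k}"]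
    by (simp del: sum_mult_indicator power_Suc sum.insert_remove add: sum.insert)
  finally show ?thesis by (meson add_increasing order_trans zero_le)
qed

text \<open>Layer \<open>k\<close> has weight \<open>2 ^ Suc k\<close> and measure at most
  \<open>C * (1/4) ^ k\<close>, so it contributes at most \<open>2 * C * (1/2) ^ k\<close>; these
  bounds sum to \<open>4 * C\<close>.\<close>

lemma nn_integral_inverse_sqrt_le:
  assumes f[measurable]: "f \<in> borel_measurable N" and C: "0 \<le> C"
    and small: "\<And>s. 0 < s \<Longrightarrow> emeasure N {x \<in> space N. \<bar>f x\<bar> \<le> s} \<le> ennreal (C * s)"
  shows "(\<integral>\<^sup>+x. ennreal (1 / sqrt \<bar>f x\<bar>) \<partial>N) \<le> emeasure N (space N) + ennreal (4 * C)"
proof -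
  let ?I = "\<lambda>k x. indicator {y::real. \<bar>y\<bar> \<le> (1/4) ^ k} (f x) :: ennreal"
  have "(\<integral>\<^sup>+x. ennreal (1 / sqrt \<bar>f x\<bar>) \<partial>N) \<le> (\<integral>\<^sup>+x. 1 + (\<Sum>k. ennreal (2 ^ Suc k) * ?I k x) \<partial>N)"
    by (intro nn_integral_mono inverse_sqrt_le_layers)
  also have "\<dots> = emeasure N (space N) + (\<Sum>k. \<integral>\<^sup>+x. ennreal (2 ^ Suc k) * ?I k x \<partial>N)"
    by (subst nn_integral_add) (auto simp: nn_integral_suminf)
  finally have eq: "(\<integral>\<^sup>+x. ennreal (1 / sqrt \<bar>f x\<bar>) \<partial>N)
    \<le> emeasure N (space N) + (\<Sum>k. \<integral>\<^sup>+x. ennreal (2 ^ Suc k) * ?I k x \<partial>N)" .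
  have "(\<Sum>k. \<integral>\<^sup>+x. ennreal (2 ^ Suc k) * ?I k x \<partial>N) \<le> (\<Sum>k. ennreal (2 * C * (1/2) ^ k))"
  proof (rule suminf_le)
    fix k
    have "(\<integral>\<^sup>+x. ennreal (2 ^ Suc k) * ?I k x \<partial>N)
        = ennreal (2 ^ Suc k) * (\<integral>\<^sup>+x. indicator {x \<in> space N. \<bar>f x\<bar> \<le> (1/4) ^ k} x \<partial>N)"
      by (subst nn_integral_cmult, measurable)
        (intro nn_integral_cong arg_cong2[where f="(*)"] refl, auto split: split_indicator)
    also have "\<dots> = ennreal (2 ^ Suc k) * emeasure N {x \<in> space N. \<bar>f x\<bar> \<le> (1/4) ^ k}"
      by (subst nn_integral_indicator) measurable
    also have "\<dots> \<le> ennreal (2 ^ Suc k) * ennreal (C * (1/4) ^ k)"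
      by (intro mult_left_mono small) auto
    also have "\<dots> = ennreal (2 ^ Suc k * (C * (1/4) ^ k))"
      by (rule ennreal_mult'[symmetric]) (use C in auto)
    also have "2 ^ Suc k * (C * (1/4) ^ k) = 2 * C * (2 * (1/4)) ^ k"
      unfolding power_mult_distrib by simp
    also have "\<dots> = 2 * C * (1/2) ^ k" by simp
    finally show "(\<integral>\<^sup>+x. ennreal (2 ^ Suc k) * ?I k x \<partial>N) \<le> ennreal (2 * C * (1/2) ^ k)" .
  qed auto
  also have "(\<Sum>k. ennreal (2 * C * (1/2) ^ k)) = ennreal (\<Sum>k. 2 * C * (1/2) ^ k)"
    by (intro suminf_ennreal2 summable_mult summable_geometric) (use C in auto)
  also have "(\<Sum>k. 2 * C * (1/2::real) ^ k) = 4 * C"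
    using sums_mult[OF geometric_sums[of "1/2::real"], of "2 * C"] by (simp add: sums_iff)
  finally have "(\<Sum>k. \<integral>\<^sup>+x. ennreal (2 ^ Suc k) * ?I k x \<partial>N) \<le> ennreal (4 * C)" .
  from order_trans[OF eq add_left_mono[OF this]] show ?thesis .
qed

subsection \<open>Uniform directions on the sphere\<close>

lemma sets_sphere_measure [simp, measurable_cong]:
  "sets (sphere_measure :: 'a::euclidean_space measure) = sets borel"
  by (simp add: sphere_measure_def)

text \<open>Radial projection of a point of the open unit ball can only increase |e \<bullet> x|.
  Hence the points of the ball that are projected into the slab already lie in it, and the bound for
  the ball applies.\<close>

lemma emeasure_sphere_measure_slab_le:
  fixes e :: "'a::euclidean_space"
  assumes e: "norm e = 1" and s: "0 < s"
  shows "emeasure sphere_measure {u. \<bar>e \<bullet> u\<bar> \<le> s}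
    \<le> ennreal (6 * s * real DIM('a)) * emeasure lborel (ball (0::'a) 2)"
proof -
  let ?p = "\<lambda>x::'a. (1 / norm x) *\<^sub>R x"
  let ?R = "restrict_space lborel (ball (0::'a) 1)"
  have p: "?p \<in> ?R \<rightarrow>\<^sub>M borel"
    by (rule measurable_restrict_space1) measurable
  have B: "{u. \<bar>e \<bullet> u\<bar> \<le> s} \<in> sets borel" by measurable
  have "emeasure (distr ?R borel ?p) {u. \<bar>e \<bullet> u\<bar> \<le> s}
    = emeasure ?R (?p -` {u. \<bar>e \<bullet> u\<bar> \<le> s} \<inter> space ?R)"
    by (rule emeasure_distr[OF p]) (use B in simp)
  also have "\<dots> = emeasure lborel (?p -` {u. \<bar>e \<bullet> u\<bar> \<le> s} \<inter> ball 0 1)"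
    by (subst emeasure_restrict_space) (auto simp: space_restrict_space)
  also have "\<dots> \<le> emeasure lborel {x \<in> ball 0 1. \<bar>e \<bullet> x\<bar> \<le> s}"
  proof (rule emeasure_mono)
    show "?p -` {u. \<bar>e \<bullet> u\<bar> \<le> s} \<inter> ball 0 1 \<subseteq> {x \<in> ball 0 1. \<bar>e \<bullet> x\<bar> \<le> s}"
    proof (clarsimp)
      fix x assume x: "norm x < 1" "\<bar>e \<bullet> x\<bar> / norm x \<le> s"
      show "\<bar>e \<bullet> x\<bar> \<le> s"
      proof (cases "x = 0")
        case False
        then have "\<bar>e \<bullet> x\<bar> \<le> s * norm x" using x by (simp add: divide_le_eq)
        also have "\<dots> \<le> s" using x s by simp
        finally show ?thesis .
      qed (use s in simp)
    qed
    have "{x \<in> ball (0::'a) 1. \<bar>e \<bullet> x\<bar> \<le> s} \<in> sets borel" by measurable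
    then show "{x \<in> ball (0::'a) 1. \<bar>e \<bullet> x\<bar> \<le> s} \<in> sets lborel" by simp
  qed
  also have "\<dots> \<le> ennreal (6 * s) * emeasure lborel (ball (0::'a) 2)"
    by (rule emeasure_ball_slab_le[OF e s])
  finally have le: "emeasure (distr ?R borel ?p) {u. \<bar>e \<bullet> u\<bar> \<le> s}
    \<le> ennreal (6 * s) * emeasure lborel (ball (0::'a) 2)" .
  have "emeasure sphere_measure {u. \<bar>e \<bullet> u\<bar> \<le> s}
    = of_nat DIM('a) * emeasure (distr ?R borel ?p) {u. \<bar>e \<bullet> u\<bar> \<le> s}"
    by (simp add: sphere_measure_def)
  also have "\<dots> \<le> of_nat DIM('a) * (ennreal (6 * s) * emeasure lborel (ball (0::'a) 2))"
    by (intro mult_left_mono le) simp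
  also have "\<dots> = ennreal (6 * s * real DIM('a)) * emeasure lborel (ball (0::'a) 2)"
    using s by (simp add: ennreal_mult ennreal_of_nat_eq_real_of_nat mult_ac)
  finally show ?thesis .
qed

text \<open>Divide the bound for the whole sphere by the positive surface measure of
  \<open>S\<close>. One constant serves all directions \<open>e\<close>; later \<open>e\<close>
  varies with the increment \<open>h\<close>.\<close>

lemma uniform_sphere_slab:
  fixes U :: "'p \<Rightarrow> 'a::euclidean_space"
  assumes U[measurable]: "U \<in> borel_measurable M"
    and S: "S \<in> sets borel" "emeasure sphere_measure S > 0"
    and d: "distr M borel U = uniform_measure sphere_measure S"
  obtains C where "C \<ge> 0"
    "\<And>e s. norm e = 1 \<Longrightarrow> 0 < s \<Longrightarrow> emeasure M {\<omega> \<in> space M. \<bar>e \<bullet> U \<omega>\<bar> \<le> s} \<le> ennreal (C * s)"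
proof
  let ?V = "emeasure lborel (ball (0::'a) 2)"
  define c where "c = ennreal (6 * real DIM('a)) * ?V / emeasure sphere_measure S"
  have "?V < \<infinity>" using emeasure_lborel_ball_finite by simp
  then have c: "c < \<infinity>" unfolding c_def using S(2)
    by (auto simp: ennreal_divide_eq_top_iff ennreal_mult_eq_top_iff less_top[symmetric])
  show "0 \<le> enn2real c" by simp
  fix e :: 'a and s :: real assume e: "norm e = 1" and s: "0 < s"
  let ?B = "{u. \<bar>e \<bullet> u\<bar> \<le> s}"
  have B: "?B \<in> sets borel" by measurable
  have "emeasure M {\<omega> \<in> space M. \<bar>e \<bullet> U \<omega>\<bar> \<le> s} = emeasure (distr M borel U) ?B"
    using B by (subst emeasure_distr) (auto intro!: arg_cong2[where f=emeasure])
  also have "\<dots> = emeasure sphere_measure (S \<inter> ?B) / emeasure sphere_measure S"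
    unfolding d using S B by (intro emeasure_uniform_measure) simp_all
  also have "\<dots> \<le> (ennreal (6 * s * real DIM('a)) * ?V) / emeasure sphere_measure S"
  proof (rule divide_right_mono_ennreal)
    have "emeasure sphere_measure (S \<inter> ?B) \<le> emeasure sphere_measure ?B"
      by (rule emeasure_mono) (use B in auto)
    with emeasure_sphere_measure_slab_le[OF e s]
    show "emeasure sphere_measure (S \<inter> ?B) \<le> ennreal (6 * s * real DIM('a)) * ?V" by simp
  qed
  also have "\<dots> = c * ennreal s"
    using s by (simp add: c_def ennreal_mult divide_ennreal_def mult_ac)
  also have "\<dots> = ennreal (enn2real c * s)"
    using c s by (simp add: ennreal_mult less_top[symmetric])
  finally show "emeasure M {\<omega> \<in> space M. \<bar>e \<bullet> U \<omega>\<bar> \<le> s} \<le> ennreal (enn2real c * s)" by simp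
qed

text \<open>Let \<open>s\<close> tend to 0. Applied to \<open>e \<bullet> U\<close>, this shows that
  the direction almost surely avoids a given hyperplane through the origin.\<close>

lemma AE_neq_0_of_small_values:
  assumes f[measurable]: "f \<in> borel_measurable M" and C: "C \<ge> 0"
    and small: "\<And>s. 0 < s \<Longrightarrow> emeasure M {\<omega> \<in> space M. \<bar>f \<omega>\<bar> \<le> s} \<le> ennreal (C * s)"
  shows "AE \<omega> in M. f \<omega> \<noteq> (0::real)"
proof -
  have "emeasure M {\<omega> \<in> space M. f \<omega> = 0} \<le> 0"
  proof (rule ennreal_le_epsilon)
    fix \<epsilon> :: real assume \<epsilon>: "0 < \<epsilon>"
    have "emeasure M {\<omega> \<in> space M. f \<omega> = 0} \<le> emeasure M {\<omega> \<in> space M. \<bar>f \<omega>\<bar> \<le> \<epsilon> / (C + 1)}"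
      using C \<epsilon> by (intro emeasure_mono) auto
    also have "\<dots> \<le> ennreal (C * (\<epsilon> / (C + 1)))" using C \<epsilon> by (intro small) simp
    also have "\<dots> \<le> ennreal \<epsilon>" using C \<epsilon> by (intro ennreal_leI) (simp add: field_simps)
    finally show "emeasure M {\<omega> \<in> space M. f \<omega> = 0} \<le> 0 + ennreal \<epsilon>" by simp
  qed
  then show ?thesis by (subst AE_iff_measurable[OF _ refl]) auto
qed

lemma prob_uniform_sphere_AE_norm:
  fixes U :: "'p \<Rightarrow> 'a::euclidean_space"
  assumes U[measurable]: "U \<in> borel_measurable M"
    and S: "S \<in> sets borel" "S \<subseteq> sphere 0 1"
    and d: "distr M borel U = uniform_measure sphere_measure S"
  shows "AE \<omega> in M. norm (U \<omega>) = 1"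
proof -
  have "AE u in uniform_measure sphere_measure S. u \<in> S"
    using S by (intro AE_uniform_measureI) auto
  then have "AE \<omega> in M. U \<omega> \<in> S"
    unfolding d[symmetric] using S by (subst (asm) AE_distr_iff) auto
  then show ?thesis by eventually_elim (use S(2) in auto)
qed

text \<open>\<open>W\<close> and \<open>U\<close> take values in different types, so the model
  states their independence through families of preimages. It is used for functions of them with a
  common value type: their preimages belong to the given families, and intersection-stable families
  generate independent sigma-algebras.\<close>

lemma (in prob_space) indep_var_of_vimage:
  fixes f :: "'w::topological_space \<Rightarrow> 'c::topological_space" and f' :: "'u::topological_space \<Rightarrow> 'c"
  assumes ind: "indep_set {W -` A \<inter> space M |A. A \<in> sets borel} {U -` B \<inter> space M |B. B \<in> sets borel}"
    and [measurable]: "W \<in> borel_measurable M" "U \<in> borel_measurable M"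
      "f \<in> borel_measurable borel" "f' \<in> borel_measurable borel"
  shows "indep_var borel (\<lambda>\<omega>. f (W \<omega>)) borel (\<lambda>\<omega>. f' (U \<omega>))"
proof -
  have st: "Int_stable {V -` A \<inter> space M |A. A \<in> sets borel}" for V :: "'a \<Rightarrow> 'c"
  proof (rule Int_stableI, clarify)
    fix A B :: "'c set" assume "A \<in> sets borel" "B \<in> sets borel"
    then show "\<exists>C. (V -` A \<inter> space M) \<inter> (V -` B \<inter> space M) = V -` C \<inter> space M \<and> C \<in> sets borel"
      by (intro exI[of _ "A \<inter> B"]) auto
  qed
  have sub: "{(\<lambda>\<omega>. k (V \<omega>)) -` A \<inter> space M |A. A \<in> sets borel} \<subseteq> {V -` A \<inter> space M |A. A \<in> sets borel}"
    if k: "k \<in> borel_measurable borel"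
    for k :: "'v::topological_space \<Rightarrow> 'c" and V :: "'a \<Rightarrow> 'v"
  proof clarify
    fix A :: "'c set" assume "A \<in> sets borel"
    then show "\<exists>B. (\<lambda>\<omega>. k (V \<omega>)) -` A \<inter> space M = V -` B \<inter> space M \<and> B \<in> sets borel"
      using measurable_sets[OF k] by (intro exI[of _ "k -` A"]) auto
  qed
  have "indep_set {(\<lambda>\<omega>. f (W \<omega>)) -` A \<inter> space M |A. A \<in> sets borel}
      {(\<lambda>\<omega>. f' (U \<omega>)) -` A \<inter> space M |A. A \<in> sets borel}"
    unfolding indep_set_def
  proof (rule indep_sets_mono_sets[OF ind[unfolded indep_set_def]])
    fix b
    show "(case b of True \<Rightarrow> {(\<lambda>\<omega>. f (W \<omega>)) -` A \<inter> space M |A. A \<in> sets borel}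
        | False \<Rightarrow> {(\<lambda>\<omega>. f' (U \<omega>)) -` A \<inter> space M |A. A \<in> sets borel})
      \<subseteq> (case b of True \<Rightarrow> {W -` A \<inter> space M |A. A \<in> sets borel}
        | False \<Rightarrow> {U -` A \<inter> space M |A. A \<in> sets borel})"
      by (cases b) (simp_all only: bool.case sub assms)
  qed
  from indep_set_sigma_sets[OF this st st] show ?thesis unfolding indep_var_eq by simp
qed

section \<open>Integrability of the inverse distance along a line\<close>

text \<open>Pythagoras splits the squared distance into the squared distance from the origin to the
  line, whose root is at least |e \<bullet> y| because \<open>e\<close> is orthogonal to
  \<open>h\<close>, and \<open>((t - t0) * norm h)\<^sup>2\<close>, where \<open>t0\<close> is the
  parameter of the nearest point. The inequality between arithmetic and geometric mean then
  separates \<open>y\<close> from \<open>t\<close> at the price of an exponent 1/2 on each, and such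
  powers are integrable where inverse first powers need not be.\<close>

lemma inverse_dist_line_le:
  fixes y h e :: "'a::real_inner"
  assumes e: "norm e = 1" "e \<bullet> h = 0" and h: "h \<noteq> 0" and y: "e \<bullet> y \<noteq> 0"
    and t: "t \<noteq> (y \<bullet> h) / (h \<bullet> h)"
  shows "1 / norm (y - t *\<^sub>R h)
    \<le> (1 / sqrt (norm h)) * (1 / sqrt \<bar>e \<bullet> y\<bar>) * (1 / sqrt \<bar>t - (y \<bullet> h) / (h \<bullet> h)\<bar>)"
proof -
  define t0 where "t0 = (y \<bullet> h) / (h \<bullet> h)"
  define p where "p = y - t0 *\<^sub>R h"
  have hh: "h \<bullet> h \<noteq> 0" using h by simp
  have ph: "p \<bullet> h = 0" using hh by (simp add: p_def t0_def inner_diff_left)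
  have "\<bar>e \<bullet> p\<bar> \<le> norm p" using Cauchy_Schwarz_ineq2[of e p] e by simp
  moreover have "e \<bullet> p = e \<bullet> y" using e by (simp add: p_def inner_diff_right)
  ultimately have pe: "\<bar>e \<bullet> y\<bar> \<le> norm p" by simp
  have "y - t *\<^sub>R h = p - (t - t0) *\<^sub>R h" by (simp add: p_def algebra_simps)
  then have "(norm (y - t *\<^sub>R h))\<^sup>2 = (p - (t - t0) *\<^sub>R h) \<bullet> (p - (t - t0) *\<^sub>R h)"
    by (simp only: power2_norm_eq_inner)
  also have "\<dots> = p \<bullet> p + (t - t0)\<^sup>2 * (h \<bullet> h)"
    using ph by (simp add: inner_diff_left inner_diff_right inner_commute power2_eq_square)
  also have "\<dots> = (norm p)\<^sup>2 + (\<bar>t - t0\<bar> * norm h)\<^sup>2"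
    by (simp add: power_mult_distrib flip: power2_norm_eq_inner)
  finally have "(norm (y - t *\<^sub>R h))\<^sup>2 = (norm p)\<^sup>2 + (\<bar>t - t0\<bar> * norm h)\<^sup>2" .
  moreover have "2 * (norm p * (\<bar>t - t0\<bar> * norm h)) \<le> (norm p)\<^sup>2 + (\<bar>t - t0\<bar> * norm h)\<^sup>2"
    using sum_squares_bound[of "norm p" "\<bar>t - t0\<bar> * norm h"] by (simp add: mult.assoc)
  moreover have "0 \<le> norm p * (\<bar>t - t0\<bar> * norm h)" by simp
  ultimately have "norm p * (\<bar>t - t0\<bar> * norm h) \<le> (norm (y - t *\<^sub>R h))\<^sup>2" by linarith
  moreover have "\<bar>e \<bullet> y\<bar> * (\<bar>t - t0\<bar> * norm h) \<le> norm p * (\<bar>t - t0\<bar> * norm h)"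
    using pe by (intro mult_right_mono) auto
  ultimately have le: "\<bar>e \<bullet> y\<bar> * (\<bar>t - t0\<bar> * norm h) \<le> (norm (y - t *\<^sub>R h))\<^sup>2" by linarith
  then have "sqrt (\<bar>e \<bullet> y\<bar> * (\<bar>t - t0\<bar> * norm h)) \<le> norm (y - t *\<^sub>R h)"
    by (intro real_le_lsqrt) auto
  moreover have pos: "0 < \<bar>e \<bullet> y\<bar> * (\<bar>t - t0\<bar> * norm h)" using y t h by (simp add: t0_def)
  ultimately have "1 / norm (y - t *\<^sub>R h) \<le> 1 / sqrt (\<bar>e \<bullet> y\<bar> * (\<bar>t - t0\<bar> * norm h))"
    by (intro divide_left_mono mult_pos_pos) (auto intro: less_le_trans[of 0])
  also have "\<dots> = (1 / sqrt (norm h)) * (1 / sqrt \<bar>e \<bullet> y\<bar>) * (1 / sqrt \<bar>t - t0\<bar>)"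
    by (simp add: real_sqrt_mult)
  finally show ?thesis by (simp add: t0_def)
qed

text \<open>By Tonelli it suffices that the double integral over \<open>t\<close> and
  \<open>\<omega>\<close> is finite. For fixed \<open>\<omega>\<close> the integral over
  \<open>t\<close> of the separated bound is controlled uniformly in the position of the nearest
  point, which leaves the integrable factor
  \<open>1 / sqrt \<bar>e \<bullet> Y \<omega>\<bar>\<close>.\<close>

lemma (in prob_space) AE_line_integrable_inverse_dist:
  fixes Y :: "'a \<Rightarrow> 'b::euclidean_space"
  assumes Y[measurable]: "Y \<in> borel_measurable M"
    and e: "norm e = 1" "e \<bullet> h = 0" and h: "h \<noteq> 0"
    and nz: "AE \<omega> in M. e \<bullet> Y \<omega> \<noteq> 0"
    and int: "integrable M (\<lambda>\<omega>. 1 / sqrt \<bar>e \<bullet> Y \<omega>\<bar>)"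
  shows "AE t in restrict_space lborel {0..1::real}. integrable M (\<lambda>\<omega>. 1 / norm (Y \<omega> - t *\<^sub>R h))"
proof -
  define N where "N = restrict_space lborel {0..1::real}"
  interpret N: finite_measure N unfolding N_def
    by (rule finite_measureI) (simp add: space_restrict_space emeasure_restrict_space)
  interpret P: pair_sigma_finite M N ..
  have spN: "space N = {0..1}" by (simp add: N_def space_restrict_space)
  have mN: "f \<in> borel_measurable N" if "f \<in> borel_measurable borel" for f :: "real \<Rightarrow> 'z::topological_space"
    using that unfolding N_def by (intro measurable_restrict_space1) simp
  have idN[measurable]: "(\<lambda>t. t) \<in> borel_measurable N" by (rule mN) simp
  \<comment> \<open>The 9 is \<open>1 + 4 * 2\<close>: the unit interval has mass 1, and the points
    within \<open>s\<close> of \<open>c\<close> have mass at most \<open>2 * s\<close>.\<close>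
  have small: "(\<integral>\<^sup>+t. ennreal (1 / sqrt \<bar>t - c\<bar>) \<partial>N) \<le> 9" for c :: real
  proof -
    have "(\<integral>\<^sup>+t. ennreal (1 / sqrt \<bar>t - c\<bar>) \<partial>N) \<le> emeasure N (space N) + ennreal (4 * 2)"
    proof (rule nn_integral_inverse_sqrt_le)
      show "(\<lambda>t. t - c) \<in> borel_measurable N" by measurable
      fix s :: real assume s: "0 < s"
      have "emeasure N {x \<in> space N. \<bar>x - c\<bar> \<le> s} = emeasure lborel {x \<in> space N. \<bar>x - c\<bar> \<le> s}"
        unfolding N_def by (rule emeasure_restrict_space) (auto simp: space_restrict_space)
      also have "\<dots> \<le> emeasure lborel {c - s..c + s}" by (intro emeasure_mono) auto
      also have "\<dots> = ennreal (2 * s)" using s by simp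
      finally show "emeasure N {x \<in> space N. \<bar>x - c\<bar> \<le> s} \<le> ennreal (2 * s)" .
    qed simp
    also have "emeasure N (space N) = 1"
      unfolding spN by (simp add: N_def emeasure_restrict_space)
    finally show ?thesis by simp
  qed
  have "(\<integral>\<^sup>+t. \<integral>\<^sup>+\<omega>. ennreal (1 / norm (Y \<omega> - t *\<^sub>R h)) \<partial>M \<partial>N)
      = (\<integral>\<^sup>+\<omega>. \<integral>\<^sup>+t. ennreal (1 / norm (Y \<omega> - t *\<^sub>R h)) \<partial>N \<partial>M)"
    by (rule P.Fubini') measurable
  also have "\<dots> \<le> (\<integral>\<^sup>+\<omega>. ennreal (1 / sqrt (norm h)) * ennreal (1 / sqrt \<bar>e \<bullet> Y \<omega>\<bar>) * 9 \<partial>M)"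
  proof (rule nn_integral_mono_AE)
    show "AE \<omega> in M. (\<integral>\<^sup>+t. ennreal (1 / norm (Y \<omega> - t *\<^sub>R h)) \<partial>N)
        \<le> ennreal (1 / sqrt (norm h)) * ennreal (1 / sqrt \<bar>e \<bullet> Y \<omega>\<bar>) * 9"
      using nz
    proof eventually_elim
      case (elim \<omega>)
      let ?c = "(Y \<omega> \<bullet> h) / (h \<bullet> h)"
      \<comment> \<open>At \<open>t = ?c\<close> the convention 1 / 0 = 0 turns the separated bound
        into 0, so this one parameter is discarded as a null set.\<close>
      have "AE t in lborel. t \<noteq> ?c" by (rule AE_lborel_singleton)
      then have "AE t in N. t \<noteq> ?c" unfolding N_def by (subst AE_restrict_space_iff) auto
      then have "AE t in N. ennreal (1 / norm (Y \<omega> - t *\<^sub>R h))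
        \<le> ennreal (1 / sqrt (norm h)) * ennreal (1 / sqrt \<bar>e \<bullet> Y \<omega>\<bar>) * ennreal (1 / sqrt \<bar>t - ?c\<bar>)"
      proof eventually_elim
        case (elim t)
        have "ennreal (1 / norm (Y \<omega> - t *\<^sub>R h)) \<le>
          ennreal ((1 / sqrt (norm h)) * (1 / sqrt \<bar>e \<bullet> Y \<omega>\<bar>) * (1 / sqrt \<bar>t - ?c\<bar>))"
          by (intro ennreal_leI inverse_dist_line_le e h elim \<open>e \<bullet> Y \<omega> \<noteq> 0\<close>)
        then show ?case by (simp only: ennreal_mult' ennreal_mult'' zero_le_divide_1_iff real_sqrt_ge_zero abs_ge_zero norm_ge_zero mult_nonneg_nonneg)
      qed
      then have "(\<integral>\<^sup>+t. ennreal (1 / norm (Y \<omega> - t *\<^sub>R h)) \<partial>N) \<le>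
        (\<integral>\<^sup>+t. ennreal (1 / sqrt (norm h)) * ennreal (1 / sqrt \<bar>e \<bullet> Y \<omega>\<bar>) * ennreal (1 / sqrt \<bar>t - ?c\<bar>) \<partial>N)"
        by (rule nn_integral_mono_AE)
      also have "\<dots> = ennreal (1 / sqrt (norm h)) * ennreal (1 / sqrt \<bar>e \<bullet> Y \<omega>\<bar>) *
          (\<integral>\<^sup>+t. ennreal (1 / sqrt \<bar>t - ?c\<bar>) \<partial>N)"
        by (rule nn_integral_cmult) measurable
      also have "\<dots> \<le> ennreal (1 / sqrt (norm h)) * ennreal (1 / sqrt \<bar>e \<bullet> Y \<omega>\<bar>) * 9"
        by (intro mult_left_mono small) simp
      finally show ?case .
    qed
  qed
  also have "\<dots> = (\<integral>\<^sup>+\<omega>. (9 * ennreal (1 / sqrt (norm h))) * ennreal (1 / sqrt \<bar>e \<bullet> Y \<omega>\<bar>) \<partial>M)"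
    by (intro nn_integral_cong) (simp add: mult_ac)
  also have "\<dots> = (9 * ennreal (1 / sqrt (norm h))) * (\<integral>\<^sup>+\<omega>. ennreal (1 / sqrt \<bar>e \<bullet> Y \<omega>\<bar>) \<partial>M)"
    by (rule nn_integral_cmult) measurable
  also have "(\<integral>\<^sup>+\<omega>. ennreal (1 / sqrt \<bar>e \<bullet> Y \<omega>\<bar>) \<partial>M) = ennreal (\<integral>\<omega>. 1 / sqrt \<bar>e \<bullet> Y \<omega>\<bar> \<partial>M)"
    by (rule nn_integral_eq_integral[OF int]) simp
  also have "(9 * ennreal (1 / sqrt (norm h))) * ennreal (\<integral>\<omega>. 1 / sqrt \<bar>e \<bullet> Y \<omega>\<bar> \<partial>M) < \<infinity>"
    by (simp add: ennreal_mult_less_top)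
  finally have fin: "(\<integral>\<^sup>+t. \<integral>\<^sup>+\<omega>. ennreal (1 / norm (Y \<omega> - t *\<^sub>R h)) \<partial>M \<partial>N) \<noteq> \<infinity>" by simp
  have "AE t in N. (\<integral>\<^sup>+\<omega>. ennreal (1 / norm (Y \<omega> - t *\<^sub>R h)) \<partial>M) \<noteq> \<infinity>"
    by (rule nn_integral_PInf_AE[OF _ fin]) measurable
  then have "AE t in N. integrable M (\<lambda>\<omega>. 1 / norm (Y \<omega> - t *\<^sub>R h))"
  proof eventually_elim
    case (elim t)
    show ?case by (rule integrableI_nonneg) (use elim in \<open>auto simp: less_top\<close>)
  qed
  then show ?thesis unfolding N_def .
qed

subsection \<open>Taylor expansion of the expected distance along a line\<close>

text \<open>The second derivative of \<open>t \<mapsto> norm (v + t h)\<close> at 0.\<close>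
definition norm_hessian :: "'a::real_inner \<Rightarrow> 'a \<Rightarrow> real" where
  "norm_hessian h v = (h \<bullet> h - (h \<bullet> v)\<^sup>2 / (norm v)\<^sup>2) / norm v"

lemma norm_hessian_nonneg: "0 \<le> norm_hessian h v"
proof (cases "v = 0")
  case False
  have "(h \<bullet> v)\<^sup>2 \<le> (h \<bullet> h) * (norm v)\<^sup>2"
    using Cauchy_Schwarz_ineq[of h v] by (simp add: power2_norm_eq_inner)
  with False show ?thesis by (simp add: norm_hessian_def divide_le_eq)
qed (simp add: norm_hessian_def)

lemma norm_hessian_measurable [measurable]:
  "norm_hessian (h :: 'a::euclidean_space) \<in> borel_measurable borel"
  unfolding norm_hessian_def by measurable

text \<open>A crude bound, meant for the integrability of the matrix under the integral in
  \<open>Gamma_mat\<close>; the size of the constant is immaterial.\<close>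

lemma norm_outer_square_le: "norm (outer_square v) \<le> real CARD('n) * (norm v)\<^sup>2" for v :: "real ^ 'n"
proof -
  have row: "outer_square v $ i = (v $ i) *\<^sub>R v" for i
    by (simp add: outer_square_def vec_eq_iff)
  have "norm (outer_square v) \<le> (\<Sum>i\<in>UNIV. norm (outer_square v $ i))"
    unfolding norm_vec_def[of "outer_square v"] by (rule L2_set_le_sum) simp
  also have "\<dots> \<le> (\<Sum>i\<in>(UNIV::'n set). (norm v)\<^sup>2)"
    unfolding row by (intro sum_mono) (simp add: power2_eq_square mult_right_mono component_le_norm_cart)
  finally show ?thesis by simp
qed

lemma outer_square_mult_vec: "outer_square v *v h = (v \<bullet> h) *\<^sub>R v"
  by (simp add: outer_square_def vec_eq_iff matrix_vector_mult_def inner_vec_def sum_distrib_left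
      sum_distrib_right mult_ac)

lemma outer_square_measurable [measurable]:
  "outer_square \<in> borel_measurable (borel :: (real ^ 'n) measure)"
  unfolding outer_square_def
  by (intro borel_measurable_continuous_onI continuous_intros)

text \<open>The matrix averaged in \<open>Gamma_mat\<close> is the Hessian of the norm. This ties
  [A3] to second derivatives of the distance along lines.\<close>

lemma Gamma_integrand_quadratic:
  "h \<bullet> (((1 / norm v) *\<^sub>R (mat 1 - (1 / (norm v)\<^sup>2) *\<^sub>R outer_square v)) *v h) = norm_hessian h v"
  by (simp add: norm_hessian_def scaleR_matrix_vector_assoc[symmetric] matrix_vector_mult_diff_rdistrib
      outer_square_mult_vec inner_diff_right power2_eq_square inner_commute)

lemma transpose_Gamma_integrand:
  "transpose ((1 / norm v) *\<^sub>R (mat 1 - (1 / (norm v)\<^sup>2) *\<^sub>R outer_square v))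
    = (1 / norm v) *\<^sub>R (mat 1 - (1 / (norm v)\<^sup>2) *\<^sub>R outer_square v)"
  by (auto simp: transpose_def vec_eq_iff mat_def outer_square_def mult.commute)

text \<open>The quadratic form at \<open>h\<close> and transposition are linear in the matrix, so
  both pass through the integral; \<open>Gamma_mat\<close> is therefore symmetric and the Rayleigh
  bound applies. The integrability hypothesis ensures that the Bochner integral is not its default
  value 0.\<close>

lemma Gamma_mat_quadratic_le:
  fixes X :: "'p \<Rightarrow> real ^ 'n"
  assumes [measurable]: "X \<in> borel_measurable M"
    and int: "integrable M (\<lambda>\<omega>. 1 / norm (X \<omega> - z))"
  shows "integrable M (\<lambda>\<omega>. norm_hessian h (X \<omega> - z))"
    and "(\<integral>\<omega>. norm_hessian h (X \<omega> - z) \<partial>M) \<le> lambda_max (Gamma_mat M X z) * (h \<bullet> h)"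
proof -
  let ?F = "\<lambda>\<omega>. (1 / norm (X \<omega> - z)) *\<^sub>R
            (mat 1 - (1 / (norm (X \<omega> - z))\<^sup>2) *\<^sub>R outer_square (X \<omega> - z))"
  let ?C = "norm (mat 1 :: real ^ 'n ^ 'n) + real CARD('n)"
  have F: "integrable M ?F"
  proof (rule Bochner_Integration.integrable_bound)
    show "integrable M (\<lambda>\<omega>. ?C * (1 / norm (X \<omega> - z)))"
      using int by (rule integrable_mult_right)
    show "AE \<omega> in M. norm (?F \<omega>) \<le> norm (?C * (1 / norm (X \<omega> - z)))"
    proof (rule AE_I2)
      fix \<omega>
      let ?v = "X \<omega> - z"
      have "norm ((1 / (norm ?v)\<^sup>2) *\<^sub>R outer_square ?v) = (1 / (norm ?v)\<^sup>2) * norm (outer_square ?v)"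
        by simp
      also have "\<dots> \<le> (1 / (norm ?v)\<^sup>2) * (real CARD('n) * (norm ?v)\<^sup>2)"
        by (intro mult_left_mono norm_outer_square_le) simp
      also have "\<dots> \<le> real CARD('n)" by simp
      finally have "norm (mat 1 - (1 / (norm ?v)\<^sup>2) *\<^sub>R outer_square ?v) \<le> ?C"
        using norm_triangle_ineq4[of "mat 1 :: real ^ 'n ^ 'n" "(1 / (norm ?v)\<^sup>2) *\<^sub>R outer_square ?v"] by linarith
      then have "(1 / norm ?v) * norm (mat 1 - (1 / (norm ?v)\<^sup>2) *\<^sub>R outer_square ?v) \<le> (1 / norm ?v) * ?C"
        by (intro mult_left_mono) auto
      then show "norm (?F \<omega>) \<le> norm (?C * (1 / norm ?v))"
        by (simp add: mult.commute)
    qed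
  qed measurable
  have bl: "bounded_linear (\<lambda>B :: real ^ 'n ^ 'n. h \<bullet> (B *v h))"
    unfolding linear_conv_bounded_linear[symmetric]
    by (rule linearI) (simp_all add: matrix_vector_mult_add_rdistrib inner_add_right scaleR_matrix_vector_assoc[symmetric])
  have bt: "bounded_linear (transpose :: real ^ 'n ^ 'n \<Rightarrow> _)"
    unfolding linear_conv_bounded_linear[symmetric]
    by (rule linearI) (simp_all add: transpose_def vec_eq_iff)
  show "integrable M (\<lambda>\<omega>. norm_hessian h (X \<omega> - z))"
    using integrable_bounded_linear[OF bl F] by (simp only: Gamma_integrand_quadratic)
  have "transpose (Gamma_mat M X z) = Gamma_mat M X z"
    unfolding Gamma_mat_def
    by (subst integral_bounded_linear[OF bt F, symmetric]) (simp only: transpose_Gamma_integrand)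
  from rayleigh_le_lambda_max[OF this, of h]
  have "h \<bullet> (Gamma_mat M X z *v h) \<le> lambda_max (Gamma_mat M X z) * (h \<bullet> h)" .
  moreover have "h \<bullet> (Gamma_mat M X z *v h) = (\<integral>\<omega>. norm_hessian h (X \<omega> - z) \<partial>M)"
    unfolding Gamma_mat_def
    by (subst integral_bounded_linear[OF bl F, symmetric]) (simp only: Gamma_integrand_quadratic)
  ultimately show "(\<integral>\<omega>. norm_hessian h (X \<omega> - z) \<partial>M) \<le> lambda_max (Gamma_mat M X z) * (h \<bullet> h)"
    by simp
qed

text \<open>The derivative of \<open>t \<mapsto> norm (y - t *\<^sub>R h)\<close>, with value 0
  where that norm vanishes.\<close>

definition norm_slope :: "'a::real_inner \<Rightarrow> 'a \<Rightarrow> real \<Rightarrow> real" where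
  "norm_slope h y t = - (h \<bullet> (y - t *\<^sub>R h)) / norm (y - t *\<^sub>R h)"

lemma abs_norm_slope_le: "\<bar>norm_slope h y t\<bar> \<le> norm h"
proof (cases "y - t *\<^sub>R h = 0")
  case False
  then show ?thesis using Cauchy_Schwarz_ineq2[of h "y - t *\<^sub>R h"]
    by (simp add: norm_slope_def divide_le_eq)
qed (simp add: norm_slope_def)

lemma norm_slope_measurable [measurable]:
  "(\<lambda>y. norm_slope h y t) \<in> borel_measurable (borel :: 'a::euclidean_space measure)"
  unfolding norm_slope_def by measurable

lemma norm_line_derivatives:
  fixes y h :: "'a::real_inner"
  assumes nz: "y - t *\<^sub>R h \<noteq> 0"
  shows "((\<lambda>t. norm (y - t *\<^sub>R h)) has_real_derivative norm_slope h y t) (at t)"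
    and "(norm_slope h y has_real_derivative norm_hessian h (y - t *\<^sub>R h)) (at t)"
proof -
  \<comment> \<open>The norm along the line is the square root of this quadratic polynomial in
    \<open>t\<close>, which reduces both derivatives to one-variable calculus.\<close>
  define p where "p t = y \<bullet> y - 2 * t * (h \<bullet> y) + t\<^sup>2 * (h \<bullet> h)" for t
  have pn: "p t = (norm (y - t *\<^sub>R h))\<^sup>2" for t
    unfolding power2_norm_eq_inner
    by (simp add: p_def inner_diff_left inner_diff_right inner_commute power2_eq_square algebra_simps)
  have n: "norm (y - t *\<^sub>R h) = sqrt (p t)" for t by (simp add: pn)
  have pos: "p t > 0" using nz by (simp add: pn)
  have hi: "h \<bullet> (y - t *\<^sub>R h) = h \<bullet> y - t * (h \<bullet> h)" for t by (simp add: inner_diff_right)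
  have dp: "(p has_real_derivative (2 * t * (h \<bullet> h) - 2 * (h \<bullet> y))) (at t)"
    unfolding p_def by (auto intro!: derivative_eq_intros)
  have scale: "inverse s / 2 * (2 * t * c - 2 * d) = - (d - t * c) / s" for s c d :: real
    by (cases "s = 0") (auto simp: field_simps)
  have ds: "((\<lambda>t. sqrt (p t)) has_real_derivative norm_slope h y t) (at t)"
    unfolding norm_slope_def n hi
    by (rule DERIV_cong[OF DERIV_chain2[OF DERIV_real_sqrt[OF pos] dp]]) (rule scale)
  then show "((\<lambda>t. norm (y - t *\<^sub>R h)) has_real_derivative norm_slope h y t) (at t)"
    by (simp add: n)
  have sq: "sqrt (p t) \<noteq> 0" using pos by simp
  have eq: "norm_slope h y = (\<lambda>t. (t * (h \<bullet> h) - h \<bullet> y) / sqrt (p t))"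
    by (rule ext) (simp add: norm_slope_def n hi)
  have d1: "((\<lambda>t. (t * (h \<bullet> h) - h \<bullet> y) / sqrt (p t)) has_real_derivative
     ((h \<bullet> h) * sqrt (p t) - (t * (h \<bullet> h) - h \<bullet> y) * norm_slope h y t) / (sqrt (p t) * sqrt (p t))) (at t)"
    by (rule derivative_eq_intros ds sq refl)+ simp
  have d2: "((h \<bullet> h) * sqrt (p t) - (t * (h \<bullet> h) - h \<bullet> y) * norm_slope h y t) / (sqrt (p t) * sqrt (p t))
     = norm_hessian h (y - t *\<^sub>R h)"
    unfolding eq norm_hessian_def n hi using sq by (simp add: field_simps power2_eq_square)
  show "(norm_slope h y has_real_derivative norm_hessian h (y - t *\<^sub>R h)) (at t)"
    unfolding eq by (rule DERIV_cong[OF d1 d2])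
qed

text \<open>\<open>(a + \<beta> (1 - t)) \<phi>' + \<beta> \<phi>\<close> is an antiderivative of \<open>(a + \<beta> (1 - t)) \<phi>''\<close>.\<close>
lemma nn_integral_norm_hessian_line:
  fixes y h :: "'a::euclidean_space"
  assumes nz: "\<And>t. t \<in> {0..1} \<Longrightarrow> y - t *\<^sub>R h \<noteq> 0" and a: "a \<ge> 0" and \<beta>: "\<beta> \<ge> 0"
  defines "R \<equiv> a * (norm_slope h y 1 - norm_slope h y 0) + \<beta> * (norm (y - h) - norm y - norm_slope h y 0)"
  shows "(\<integral>\<^sup>+t. ennreal ((a + \<beta> * (1 - t)) * norm_hessian h (y - t *\<^sub>R h)) \<partial>restrict_space lborel {0..1}) = ennreal R"
    and "0 \<le> R"
proof -
  let ?f = "\<lambda>t. (a + \<beta> * (1 - t)) * norm_hessian h (y - t *\<^sub>R h)"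
  define G where "G t = (a + \<beta> * (1 - t)) * norm_slope h y t + \<beta> * norm (y - t *\<^sub>R h)" for t
  have G: "(G has_real_derivative ?f t) (at t)" if "t \<in> {0..1}" for t
    unfolding G_def
    by (rule derivative_eq_intros norm_line_derivatives[OF nz[OF that]] refl)+ (simp add: algebra_simps)
  have f: "0 \<le> ?f t" if "t \<in> {0..1}" for t
    using that a \<beta> by (intro mult_nonneg_nonneg add_nonneg_nonneg norm_hessian_nonneg) auto
  have R: "G 1 - G 0 = R" by (simp add: G_def R_def algebra_simps)
  have "(\<integral>\<^sup>+t. ennreal (?f t) \<partial>restrict_space lborel {0..1}) = (\<integral>\<^sup>+t. ennreal (?f t) * indicator {0..1} t \<partial>lborel)"
    by (rule nn_integral_restrict_space) simp
  also have "\<dots> = ennreal (G 1 - G 0)"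
    by (rule nn_integral_FTC_Icc) (use G f in \<open>auto\<close>)
  finally show "(\<integral>\<^sup>+t. ennreal (?f t) \<partial>restrict_space lborel {0..1}) = ennreal R" by (simp add: R)
  have "G 0 \<le> G 1"
    by (rule DERIV_nonneg_imp_nondecreasing) (use G f in auto)
  then show "0 \<le> R" by (simp flip: R)
qed

text \<open>The increment of the slope and the Taylor remainder together form one integral of the
  second derivative with weight \<open>a + \<beta> * (1 - t)\<close>. Nonnegativity of
  \<open>a\<close> and \<open>\<beta>\<close> permits Tonelli, and the weight has integral
  \<open>a + \<beta> / 2\<close>. The bound \<open>hess\<close> is conditional because the inverse
  distance is known to be integrable only for almost every \<open>t\<close>.\<close>

lemma (in prob_space) expected_line_remainder_le:
  fixes Y :: "'a \<Rightarrow> 'b::euclidean_space"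
  assumes Y[measurable]: "Y \<in> borel_measurable M" and intY: "integrable M (\<lambda>\<omega>. norm (Y \<omega>))"
    and e: "norm e = 1" "e \<bullet> h = 0" and h: "h \<noteq> 0"
    and nz: "AE \<omega> in M. e \<bullet> Y \<omega> \<noteq> 0"
    and int: "integrable M (\<lambda>\<omega>. 1 / sqrt \<bar>e \<bullet> Y \<omega>\<bar>)"
    and a: "a \<ge> 0" and \<beta>: "\<beta> \<ge> 0" and L: "L \<ge> 0"
    and hess: "\<And>t. t \<in> {0..1} \<Longrightarrow> integrable M (\<lambda>\<omega>. 1 / norm (Y \<omega> - t *\<^sub>R h)) \<Longrightarrow>
      integrable M (\<lambda>\<omega>. norm_hessian h (Y \<omega> - t *\<^sub>R h)) \<and>
      (\<integral>\<omega>. norm_hessian h (Y \<omega> - t *\<^sub>R h) \<partial>M) \<le> L * (h \<bullet> h)"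
  shows "(\<integral>\<omega>. a * (norm_slope h (Y \<omega>) 1 - norm_slope h (Y \<omega>) 0)
      + \<beta> * (norm (Y \<omega> - h) - norm (Y \<omega>) - norm_slope h (Y \<omega>) 0) \<partial>M) \<le> (a + \<beta> / 2) * (L * (h \<bullet> h))"
proof -
  define N where "N = restrict_space lborel {0..1::real}"
  interpret N: finite_measure N unfolding N_def
    by (rule finite_measureI) (simp add: space_restrict_space emeasure_restrict_space)
  interpret P: pair_sigma_finite M N ..
  have idN[measurable]: "(\<lambda>t. t) \<in> borel_measurable N"
    unfolding N_def by (intro measurable_restrict_space1) simp
  define R where "R \<omega> = a * (norm_slope h (Y \<omega>) 1 - norm_slope h (Y \<omega>) 0)
      + \<beta> * (norm (Y \<omega> - h) - norm (Y \<omega>) - norm_slope h (Y \<omega>) 0)" for \<omega>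
  have slope: "integrable M (\<lambda>\<omega>. norm_slope h (Y \<omega>) t)" for t
    by (rule integrable_const_bound[of _ "norm h"]) (auto simp: abs_norm_slope_le)
  have Yh: "integrable M (\<lambda>\<omega>. norm (Y \<omega> - h))"
  proof (rule Bochner_Integration.integrable_bound)
    show "integrable M (\<lambda>\<omega>. norm (Y \<omega>) + norm h)" using intY by simp
    show "AE \<omega> in M. norm (norm (Y \<omega> - h)) \<le> norm (norm (Y \<omega>) + norm h)"
      by (rule AE_I2) (simp add: norm_triangle_ineq4)
  qed measurable
  have intR: "integrable M R" unfolding R_def
    by (intro Bochner_Integration.integrable_add Bochner_Integration.integrable_diff integrable_mult_right slope Yh intY)
  have R: "AE \<omega> in M. (\<integral>\<^sup>+t. ennreal ((a + \<beta> * (1 - t)) * norm_hessian h (Y \<omega> - t *\<^sub>R h)) \<partial>N) = ennreal (R \<omega>) \<and> 0 \<le> R \<omega>"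
    using nz
  proof eventually_elim
    case (elim \<omega>)
    \<comment> \<open>One null set serves all \<open>t\<close>: the product with \<open>e\<close>
      does not change along the line, so the line misses the origin.\<close>
    have "Y \<omega> - t *\<^sub>R h \<noteq> 0" for t
    proof
      assume "Y \<omega> - t *\<^sub>R h = 0"
      then have "e \<bullet> (Y \<omega> - t *\<^sub>R h) = 0" by simp
      with e elim show False by (simp add: inner_diff_right)
    qed
    from nn_integral_norm_hessian_line[OF this a \<beta>] show ?case by (simp add: N_def R_def)
  qed
  have "ennreal (\<integral>\<omega>. R \<omega> \<partial>M) = (\<integral>\<^sup>+\<omega>. ennreal (R \<omega>) \<partial>M)"
    by (rule nn_integral_eq_integral[OF intR, symmetric]) (use R in \<open>eventually_elim, simp\<close>)
  also have "\<dots> = (\<integral>\<^sup>+\<omega>. \<integral>\<^sup>+t. ennreal ((a + \<beta> * (1 - t)) * norm_hessian h (Y \<omega> - t *\<^sub>R h)) \<partial>N \<partial>M)"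
    by (rule nn_integral_cong_AE) (use R in \<open>eventually_elim, simp\<close>)
  also have "\<dots> = (\<integral>\<^sup>+t. \<integral>\<^sup>+\<omega>. ennreal ((a + \<beta> * (1 - t)) * norm_hessian h (Y \<omega> - t *\<^sub>R h)) \<partial>M \<partial>N)"
    by (rule P.Fubini'[symmetric]) measurable
  also have "\<dots> \<le> (\<integral>\<^sup>+t. ennreal ((a + \<beta> * (1 - t)) * (L * (h \<bullet> h))) \<partial>N)"
  proof (rule nn_integral_mono_AE)
    have "AE t in N. t \<in> {0..1}" unfolding N_def by (rule AE_I2) (simp add: space_restrict_space)
    moreover have "AE t in N. integrable M (\<lambda>\<omega>. 1 / norm (Y \<omega> - t *\<^sub>R h))"
      unfolding N_def by (rule AE_line_integrable_inverse_dist[OF Y e h nz int])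
    ultimately show "AE t in N. (\<integral>\<^sup>+\<omega>. ennreal ((a + \<beta> * (1 - t)) * norm_hessian h (Y \<omega> - t *\<^sub>R h)) \<partial>M)
        \<le> ennreal ((a + \<beta> * (1 - t)) * (L * (h \<bullet> h)))"
    proof eventually_elim
      case (elim t)
      from hess[OF elim] have i: "integrable M (\<lambda>\<omega>. norm_hessian h (Y \<omega> - t *\<^sub>R h))"
        and le: "(\<integral>\<omega>. norm_hessian h (Y \<omega> - t *\<^sub>R h) \<partial>M) \<le> L * (h \<bullet> h)" by auto
      have w: "0 \<le> a + \<beta> * (1 - t)" using a \<beta> elim by simp
      have "(\<integral>\<^sup>+\<omega>. ennreal ((a + \<beta> * (1 - t)) * norm_hessian h (Y \<omega> - t *\<^sub>R h)) \<partial>M)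
        = ennreal (\<integral>\<omega>. (a + \<beta> * (1 - t)) * norm_hessian h (Y \<omega> - t *\<^sub>R h) \<partial>M)"
        by (rule nn_integral_eq_integral) (use i w in \<open>auto simp: norm_hessian_nonneg\<close>)
      also have "\<dots> \<le> ennreal ((a + \<beta> * (1 - t)) * (L * (h \<bullet> h)))"
        using le w by (intro ennreal_leI) (simp add: mult_left_mono)
      finally show ?case .
    qed
  qed
  also have "\<dots> = (\<integral>\<^sup>+t. ennreal ((a + \<beta> * (1 - t)) * (L * (h \<bullet> h))) * indicator {0..1} t \<partial>lborel)"
    unfolding N_def by (rule nn_integral_restrict_space) simp
  also have "\<dots> = ennreal ((a * 1 + \<beta> * (1 - 1\<^sup>2 / 2)) * (L * (h \<bullet> h)) - (a * 0 + \<beta> * (0 - 0\<^sup>2 / 2)) * (L * (h \<bullet> h)))"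
    by (rule nn_integral_FTC_Icc[where F="\<lambda>t. (a * t + \<beta> * (t - t\<^sup>2 / 2)) * (L * (h \<bullet> h))"])
      (use a \<beta> L in \<open>auto intro!: derivative_eq_intros\<close>)
  also have "\<dots> = ennreal ((a + \<beta> / 2) * (L * (h \<bullet> h)))" by simp
  finally have "ennreal (\<integral>\<omega>. R \<omega> \<partial>M) \<le> ennreal ((a + \<beta> / 2) * (L * (h \<bullet> h)))" .
  then have "(\<integral>\<omega>. R \<omega> \<partial>M) \<le> (a + \<beta> / 2) * (L * (h \<bullet> h))"
    using a \<beta> L by (subst (asm) ennreal_le_iff) auto
  then show ?thesis by (simp add: R_def)
qed

section \<open>Coercivity of the expected gradient\<close>

text \<open>Here \<open>Y\<close> stands for X - \<mu> and \<open>m\<close> for E U. The law enters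
  through the three means and the remainder bound \<open>rem\<close>; the equation \<open>EY\<close>
  expresses the independence of radius and direction.\<close>

lemma (in prob_space) expected_gradient_coercive:
  fixes Y :: "'a \<Rightarrow> 'b::euclidean_space"
  assumes Y[measurable]: "Y \<in> borel_measurable M" and intY: "integrable M Y"
    and Y0: "AE \<omega> in M. Y \<omega> \<noteq> 0"
    and EY: "(\<integral>\<omega>. Y \<omega> \<partial>M) = rs *\<^sub>R m" and EN: "(\<integral>\<omega>. norm (Y \<omega>) \<partial>M) = rs"
    and EU: "(\<integral>\<omega>. (1 / norm (Y \<omega>)) *\<^sub>R Y \<omega> \<partial>M) = m"
    and rem: "\<And>\<beta>. 0 \<le> \<beta> \<Longrightarrow> h \<noteq> 0 \<Longrightarrow> (\<integral>\<omega>. a * (norm_slope h (Y \<omega>) 1 - norm_slope h (Y \<omega>) 0)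
      + \<beta> * (norm (Y \<omega> - h) - norm (Y \<omega>) - norm_slope h (Y \<omega>) 0) \<partial>M) \<le> (a + \<beta> / 2) * (L * (h \<bullet> h))"
    and a: "0 \<le> a" "a \<le> rs + Rr" and L: "0 \<le> L" and Rr: "0 \<le> Rr"
    and A: "0 < A"
  shows "(1 - (norm m)\<^sup>2 / A - L * (rs + 3/2 * Rr)) * (norm h)\<^sup>2 + (1 - A) * (a - rs)\<^sup>2
    \<le> (\<integral>\<omega>. grad_g (\<mu> + Y \<omega>) (\<mu> + h, a) \<bullet> (h, a - rs) \<partial>M)"
proof -
  define b where "b = a - rs"
  \<comment> \<open>With F z = E |X - z|, \<open>\<phi>\<close> is F at \<mu> + h and
    \<open>\<psi>\<close> is the derivative of F there in the direction \<open>h\<close>.\<close>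
  define \<phi> where "\<phi> = (\<integral>\<omega>. norm (Y \<omega> - h) \<partial>M)"
  define \<psi> where "\<psi> = (\<integral>\<omega>. norm_slope h (Y \<omega>) 1 \<partial>M)"
  have intn: "integrable M (\<lambda>\<omega>. norm (Y \<omega>))" using intY by simp
  have Yh[simp]: "integrable M (\<lambda>\<omega>. norm (Y \<omega> - h))" using intY by simp
  have slope[simp]: "integrable M (\<lambda>\<omega>. norm_slope h (Y \<omega>) t)" for t
    by (rule integrable_const_bound[of _ "norm h"]) (auto simp: abs_norm_slope_le)
  have intU: "integrable M (\<lambda>\<omega>. (1 / norm (Y \<omega>)) *\<^sub>R Y \<omega>)"
    by (rule integrable_const_bound[of _ 1]) auto
  have \<psi>0: "(\<integral>\<omega>. norm_slope h (Y \<omega>) 0 \<partial>M) = - (h \<bullet> m)"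
  proof -
    have "(\<integral>\<omega>. norm_slope h (Y \<omega>) 0 \<partial>M) = (\<integral>\<omega>. - (h \<bullet> ((1 / norm (Y \<omega>)) *\<^sub>R Y \<omega>)) \<partial>M)"
      by (intro Bochner_Integration.integral_cong) (auto simp: norm_slope_def)
    also have "\<dots> = - (h \<bullet> m)" using intU by (simp add: EU[symmetric] del: inner_scaleR_right)
    finally show ?thesis .
  qed
  have EYh: "(\<integral>\<omega>. h \<bullet> Y \<omega> \<partial>M) = rs * (h \<bullet> m)" using intY by (simp add: EY)
  \<comment> \<open>The integrands agree at every \<open>\<omega>\<close>, even where
    \<open>Y \<omega> = h\<close>: there \<open>grad_g\<close> and \<open>norm_slope\<close> follow
    the same convention 1 / 0 = 0.\<close>
  have "(\<integral>\<omega>. grad_g (\<mu> + Y \<omega>) (\<mu> + h, a) \<bullet> (h, b) \<partial>M)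
    = (\<integral>\<omega>. h \<bullet> h - h \<bullet> Y \<omega> - a * norm_slope h (Y \<omega>) 1 + (a - norm (Y \<omega> - h)) * b \<partial>M)"
  proof (intro Bochner_Integration.integral_cong refl)
    fix \<omega>
    have "norm (h - Y \<omega>) = norm (Y \<omega> - h)" by (rule norm_minus_commute)
    then show "grad_g (\<mu> + Y \<omega>) (\<mu> + h, a) \<bullet> (h, b)
      = h \<bullet> h - h \<bullet> Y \<omega> - a * norm_slope h (Y \<omega>) 1 + (a - norm (Y \<omega> - h)) * b"
      by (simp add: grad_g_def norm_slope_def inner_diff_left inner_diff_right inner_commute diff_divide_distrib algebra_simps)
  qed
  also have "\<dots> = h \<bullet> h - rs * (h \<bullet> m) - a * \<psi> + (a - \<phi>) * b"
    using intY by (simp add: EYh \<psi>_def \<phi>_def prob_space)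
  finally have E: "(\<integral>\<omega>. grad_g (\<mu> + Y \<omega>) (\<mu> + h, a) \<bullet> (h, b) \<partial>M)
    = h \<bullet> h - rs * (h \<bullet> m) - a * \<psi> + (a - \<phi>) * b" .
  have main: "(1 - (norm m)\<^sup>2 / A - L * (rs + 3/2 * Rr)) * (norm h)\<^sup>2 + (1 - A) * b\<^sup>2
    \<le> h \<bullet> h - rs * (h \<bullet> m) - a * \<psi> + (a - \<phi>) * b"
  proof -
    have rem': "a * (\<psi> + h \<bullet> m) + \<beta> * (\<phi> - rs + h \<bullet> m) \<le> (a + \<beta> / 2) * (L * (h \<bullet> h))"
      if \<beta>: "0 \<le> \<beta>" for \<beta>
    proof (cases "h = 0")
      case True
      then show ?thesis using EN by (simp add: \<psi>_def \<phi>_def norm_slope_def)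
    next
      case False
      have "(\<integral>\<omega>. a * (norm_slope h (Y \<omega>) 1 - norm_slope h (Y \<omega>) 0)
        + \<beta> * (norm (Y \<omega> - h) - norm (Y \<omega>) - norm_slope h (Y \<omega>) 0) \<partial>M)
        = a * (\<psi> + h \<bullet> m) + \<beta> * (\<phi> - rs + h \<bullet> m)"
        using intn by (simp add: \<psi>0 EN \<psi>_def \<phi>_def)
      with rem[OF \<beta> False] show ?thesis by simp
    qed
    \<comment> \<open>The norm is convex, so it lies above its tangent at \<open>Y \<omega>\<close>;
      pointwise this is the Cauchy-Schwarz inequality.\<close>
    have convex: "0 \<le> \<phi> - rs + h \<bullet> m"
    proof -
      have "0 \<le> (\<integral>\<omega>. norm (Y \<omega> - h) - norm (Y \<omega>) - norm_slope h (Y \<omega>) 0 \<partial>M)"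
      proof (rule integral_nonneg_AE)
        show "AE \<omega> in M. 0 \<le> norm (Y \<omega> - h) - norm (Y \<omega>) - norm_slope h (Y \<omega>) 0"
          using Y0
        proof eventually_elim
          case (elim \<omega>)
          have "Y \<omega> \<bullet> (Y \<omega> - h) \<le> norm (Y \<omega>) * norm (Y \<omega> - h)"
            by (rule norm_cauchy_schwarz)
          then have "(norm (Y \<omega>))\<^sup>2 - h \<bullet> Y \<omega> \<le> norm (Y \<omega>) * norm (Y \<omega> - h)"
            by (simp add: inner_diff_right power2_norm_eq_inner inner_commute)
          with elim show ?case
            by (simp add: norm_slope_def field_simps power2_eq_square)
        qed
      qed
      also have "\<dots> = \<phi> - rs + h \<bullet> m" using intn by (simp add: \<psi>0 EN \<phi>_def)
      finally show ?thesis .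
    qed
    \<comment> \<open>For negative \<open>b\<close> the term
      \<open>b * (\<phi> - rs + h \<bullet> m)\<close> is at most 0 by convexity, so only the
      positive part of \<open>b\<close> has to be paid for. It is at most \<open>Rr\<close>, and
      \<open>a + \<beta> / 2\<close> stays below the denominator \<open>rs + 3/2 * Rr\<close> of
      [A3].\<close>
    define \<beta> where "\<beta> = max b 0"
    have "a * (\<psi> + h \<bullet> m) + b * (\<phi> - rs + h \<bullet> m) \<le> a * (\<psi> + h \<bullet> m) + \<beta> * (\<phi> - rs + h \<bullet> m)"
      using convex by (intro add_left_mono mult_right_mono) (auto simp: \<beta>_def)
    also have "\<dots> \<le> (a + \<beta> / 2) * (L * (h \<bullet> h))" by (rule rem') (simp add: \<beta>_def)
    also have "\<dots> \<le> (rs + 3/2 * Rr) * (L * (h \<bullet> h))"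
    proof (rule mult_right_mono)
      have "\<beta> \<le> Rr" using a Rr by (simp add: \<beta>_def b_def)
      with a show "a + \<beta> / 2 \<le> rs + 3/2 * Rr" by linarith
    qed (use L in simp)
    also have "\<dots> = L * (rs + 3/2 * Rr) * (norm h)\<^sup>2"
      by (simp only: power2_norm_eq_inner mult.assoc mult.left_commute)
    finally have 1: "a * (\<psi> + h \<bullet> m) + b * (\<phi> - rs + h \<bullet> m) \<le> L * (rs + 3/2 * Rr) * (norm h)\<^sup>2" .
    \<comment> \<open>Young's inequality with the weight \<open>A\<close> of [A3]:
      \<open>A < 1\<close> leaves part of \<open>b\<^sup>2\<close>, while the other part is what
      [A3] subtracts from 1.\<close>
    have 2: "- 2 * b * (h \<bullet> m) \<le> A * b\<^sup>2 + (norm m)\<^sup>2 / A * (norm h)\<^sup>2"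
    proof -
      have "- 2 * b * (h \<bullet> m) \<le> 2 * \<bar>b\<bar> * \<bar>h \<bullet> m\<bar>"
        using abs_ge_self[of "- 2 * b * (h \<bullet> m)"] by (simp add: abs_mult)
      also have "\<dots> \<le> 2 * \<bar>b\<bar> * (norm h * norm m)"
        by (intro mult_left_mono Cauchy_Schwarz_ineq2) simp
      also have "\<dots> = 2 * (sqrt A * \<bar>b\<bar>) * (norm m * norm h / sqrt A)"
        using A by simp
      also have "\<dots> \<le> (sqrt A * \<bar>b\<bar>)\<^sup>2 + (norm m * norm h / sqrt A)\<^sup>2"
        by (rule sum_squares_bound)
      also have "\<dots> = A * b\<^sup>2 + (norm m)\<^sup>2 / A * (norm h)\<^sup>2"
        using A by (simp add: power_mult_distrib power_divide)
      finally show ?thesis .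
    qed
    have "h \<bullet> h - rs * (h \<bullet> m) - a * \<psi> + (a - \<phi>) * b
      = (norm h)\<^sup>2 + b\<^sup>2 + 2 * b * (h \<bullet> m) - (a * (\<psi> + h \<bullet> m) + b * (\<phi> - rs + h \<bullet> m))"
      unfolding power2_norm_eq_inner by (simp add: b_def power2_eq_square algebra_simps)
    with 1 2 show ?thesis by (simp add: left_diff_distrib)
  qed
  with E show ?thesis by (simp add: b_def)
qed

text \<open>Dimension at least 2 enters here: it supplies a direction \<open>e\<close> that is
  constant along the line spanned by \<open>h\<close>.\<close>

lemma exists_unit_orthogonal:
  fixes h :: "'a::euclidean_space"
  assumes "2 \<le> DIM('a)"
  obtains e where "norm e = 1" "e \<bullet> h = 0"
proof -
  obtain y where "y \<noteq> 0" "orthogonal h y" using orthogonal_to_vector_exists[OF assms] by blast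
  then show ?thesis
    by (intro that[of "y /\<^sub>R norm y"]) (auto simp: orthogonal_def inner_commute)
qed

text \<open>The work is to derive the hypotheses of the two preceding estimates from the model: [A2]
  gives the first moments, [A1] and the slab bound give the integrability of
  \<open>1 / sqrt \<bar>e \<bullet> Y \<omega>\<bar>\<close>, and [A3] bounds the Hessian
  term.\<close>

lemma (in prob_space) truncated_spherical_model_coercive:
  fixes \<mu> :: "real ^ 'n" and X :: "'a \<Rightarrow> real ^ 'n"
  assumes dim: "CARD('n) \<ge> 2"
    and model: "truncated_spherical_model M \<mu> r W S U X"
    and rstar: "rstar = r * (\<integral>\<omega>. W \<omega> \<partial>M)" "rstar > 0"
    and A1: "integrable M (\<lambda>\<omega>. 1 / (norm (X \<omega> - \<mu>))\<^sup>2)"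
    and A2: "integrable M (\<lambda>\<omega>. (norm (X \<omega> - \<mu>))\<^sup>2)"
    and A3: "Rr > 0"
      "\<exists>A. (norm (\<integral>\<omega>. U \<omega> \<partial>M))\<^sup>2 < A \<and> A < 1 \<and>
           (SUP z\<in>cball \<mu> Rm. ereal (lambda_max (Gamma_mat M X z)))
             < ereal ((1 - (norm (\<integral>\<omega>. U \<omega> \<partial>M))\<^sup>2 / A) / (rstar + 3/2 * Rr))"
  obtains c where "c > 0"
    "\<And>y. fst y \<in> cball \<mu> Rm \<Longrightarrow> 0 \<le> snd y \<Longrightarrow> snd y \<le> rstar + Rr \<Longrightarrow>
      c * (norm (y - (\<mu>, rstar)))\<^sup>2 \<le> (\<integral>\<omega>. grad_g (X \<omega>) y \<bullet> (y - (\<mu>, rstar)) \<partial>M)"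
proof -
  define m where "m = (\<integral>\<omega>. U \<omega> \<partial>M)"
  have r: "r > 0" and [measurable]: "W \<in> borel_measurable M" and W: "AE \<omega> in M. W \<omega> > 0"
    and S: "S \<subseteq> sphere 0 1" "S \<in> sets borel" "emeasure sphere_measure S > 0"
    and [measurable]: "U \<in> borel_measurable M" and dU: "distr M borel U = uniform_measure sphere_measure S"
    and ind0: "indep_set {W -` A \<inter> space M |A. A \<in> sets borel} {U -` B \<inter> space M |B. B \<in> sets borel}"
    and X: "X = (\<lambda>\<omega>. \<mu> + (r * W \<omega>) *\<^sub>R U \<omega>)"
    using model unfolding truncated_spherical_model_def by auto
  define Y where "Y \<omega> = (r * W \<omega>) *\<^sub>R U \<omega>" for \<omega>
  have Y[measurable]: "Y \<in> borel_measurable M" unfolding Y_def by measurable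
  have XY: "X \<omega> = \<mu> + Y \<omega>" for \<omega> by (simp add: X Y_def)
  have U1: "AE \<omega> in M. norm (U \<omega>) = 1" by (rule prob_uniform_sphere_AE_norm[OF _ S(2,1) dU]) measurable
  have nY: "AE \<omega> in M. norm (Y \<omega>) = r * W \<omega>"
    using U1 W by eventually_elim (use r in \<open>simp add: Y_def\<close>)
  have A1': "integrable M (\<lambda>\<omega>. 1 / (norm (Y \<omega>))\<^sup>2)" and A2': "integrable M (\<lambda>\<omega>. (norm (Y \<omega>))\<^sup>2)"
    using A1 A2 by (simp_all add: XY)
  have intn: "integrable M (\<lambda>\<omega>. norm (Y \<omega>))"
  proof (rule Bochner_Integration.integrable_bound)
    show "integrable M (\<lambda>\<omega>. 1 + (norm (Y \<omega>))\<^sup>2)" using A2' by simp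
    show "AE \<omega> in M. norm (norm (Y \<omega>)) \<le> norm (1 + (norm (Y \<omega>))\<^sup>2)"
    proof (rule AE_I2)
      fix \<omega>
      have "2 * norm (Y \<omega>) \<le> 1 + (norm (Y \<omega>))\<^sup>2"
        using sum_squares_bound[of 1 "norm (Y \<omega>)"] by simp
      then have "norm (Y \<omega>) \<le> 1 + (norm (Y \<omega>))\<^sup>2" using norm_ge_zero[of "Y \<omega>"] by linarith
      then show "norm (norm (Y \<omega>)) \<le> norm (1 + (norm (Y \<omega>))\<^sup>2)" by simp
    qed
  qed measurable
  then have intY: "integrable M Y" using integrable_norm_iff[OF Y] by simp
  have Y0: "AE \<omega> in M. Y \<omega> \<noteq> 0" using nY W by eventually_elim (use r in auto)
  have intW: "integrable M W"
  proof -
    have "integrable M (\<lambda>\<omega>. norm (Y \<omega>) / r)" using intn by simp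
    moreover have "AE \<omega> in M. norm (Y \<omega>) / r = W \<omega>" using nY by eventually_elim (use r in simp)
    ultimately show ?thesis by (subst (asm) integrable_cong_AE) auto
  qed
  have intU: "integrable M U" by (rule integrable_const_bound[of _ 1]) (use U1 in auto)
  have EN: "(\<integral>\<omega>. norm (Y \<omega>) \<partial>M) = rstar"
  proof -
    have "(\<integral>\<omega>. norm (Y \<omega>) \<partial>M) = (\<integral>\<omega>. r * W \<omega> \<partial>M)" by (rule integral_cong_AE) (use nY in auto)
    then show ?thesis by (simp add: rstar)
  qed
  have EU: "(\<integral>\<omega>. (1 / norm (Y \<omega>)) *\<^sub>R Y \<omega> \<partial>M) = m"
    unfolding m_def
  proof (rule integral_cong_AE)
    show "AE \<omega> in M. (1 / norm (Y \<omega>)) *\<^sub>R Y \<omega> = U \<omega>"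
      using nY W by eventually_elim (use r in \<open>simp add: Y_def\<close>)
  qed measurable
  have EY: "(\<integral>\<omega>. Y \<omega> \<partial>M) = rstar *\<^sub>R m"
  proof (rule euclidean_eqI)
    fix b :: "real ^ 'n"
    have "indep_var borel (\<lambda>\<omega>. W \<omega>) borel (\<lambda>\<omega>. U \<omega> \<bullet> b)"
      by (rule indep_var_of_vimage[OF ind0]) measurable
    from indep_var_lebesgue_integral[OF this intW] intU
    have E: "(\<integral>\<omega>. W \<omega> * (U \<omega> \<bullet> b) \<partial>M) = (\<integral>\<omega>. W \<omega> \<partial>M) * (m \<bullet> b)" by (simp add: m_def)
    have "(\<integral>\<omega>. Y \<omega> \<partial>M) \<bullet> b = (\<integral>\<omega>. Y \<omega> \<bullet> b \<partial>M)" using intY by simp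
    also have "\<dots> = (\<integral>\<omega>. r * (W \<omega> * (U \<omega> \<bullet> b)) \<partial>M)" by (simp add: Y_def mult.assoc)
    also have "\<dots> = r * ((\<integral>\<omega>. W \<omega> \<partial>M) * (m \<bullet> b))" by (simp add: E)
    finally show "(\<integral>\<omega>. Y \<omega> \<partial>M) \<bullet> b = (rstar *\<^sub>R m) \<bullet> b" by (simp add: rstar mult.assoc)
  qed
  obtain C where C: "C \<ge> 0" and slab: "\<And>e s. norm e = 1 \<Longrightarrow> 0 < s \<Longrightarrow>
      emeasure M {\<omega> \<in> space M. \<bar>e \<bullet> U \<omega>\<bar> \<le> s} \<le> ennreal (C * s)"
    using uniform_sphere_slab[OF _ S(2,3) dU] by auto
  have nz: "AE \<omega> in M. e \<bullet> Y \<omega> \<noteq> 0" if e: "norm e = 1" for e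
  proof -
    have "AE \<omega> in M. e \<bullet> U \<omega> \<noteq> 0"
      by (rule AE_neq_0_of_small_values[OF _ C slab[OF e]]) measurable
    with W show ?thesis by eventually_elim (use r in \<open>simp add: Y_def\<close>)
  qed
  \<comment> \<open>The integrand factors into an inverse square root of the radius, dominated by 1
    plus the inverse square of [A1], and an inverse square root of
    \<open>\<bar>e \<bullet> U \<omega>\<bar>\<close>, integrable by the slab bound. Independence
    makes the product integrable.\<close>
  have int: "integrable M (\<lambda>\<omega>. 1 / sqrt \<bar>e \<bullet> Y \<omega>\<bar>)" if e: "norm e = 1" for e
  proof -
    have iU: "integrable M (\<lambda>\<omega>. 1 / sqrt \<bar>e \<bullet> U \<omega>\<bar>)"
    proof (rule integrableI_nonneg)
      have "(\<integral>\<^sup>+\<omega>. ennreal (1 / sqrt \<bar>e \<bullet> U \<omega>\<bar>) \<partial>M) \<le> emeasure M (space M) + ennreal (4 * C)"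
        by (rule nn_integral_inverse_sqrt_le[OF _ C slab[OF e]]) measurable
      also have "\<dots> < \<infinity>" by (simp add: emeasure_space_1)
      finally show "(\<integral>\<^sup>+\<omega>. ennreal (1 / sqrt \<bar>e \<bullet> U \<omega>\<bar>) \<partial>M) < \<infinity>" .
    qed auto
    have iW: "integrable M (\<lambda>\<omega>. 1 / sqrt \<bar>r * W \<omega>\<bar>)"
    proof (rule Bochner_Integration.integrable_bound)
      show "integrable M (\<lambda>\<omega>. 1 + 1 / (norm (Y \<omega>))\<^sup>2)" using A1' by simp
      show "AE \<omega> in M. norm (1 / sqrt \<bar>r * W \<omega>\<bar>) \<le> norm (1 + 1 / (norm (Y \<omega>))\<^sup>2)"
        using nY W
      proof eventually_elim
        case (elim \<omega>)
        define \<rho> where "\<rho> = norm (Y \<omega>)"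
        have \<rho>: "\<rho> > 0" "r * W \<omega> = \<rho>" using elim r by (auto simp: \<rho>_def)
        have "1 / sqrt \<rho> \<le> 1 + 1 / \<rho>\<^sup>2"
        proof (cases "\<rho> \<le> 1")
          case True
          then have "\<rho>\<^sup>2 \<le> \<rho>" using \<rho> by (simp add: power2_eq_square mult_left_le)
          then have "\<rho>\<^sup>2 \<le> sqrt \<rho>" using \<rho> True
            by (smt (verit) real_le_rsqrt)
          then have "1 / sqrt \<rho> \<le> 1 / \<rho>\<^sup>2" using \<rho> by (intro divide_left_mono) auto
          then show ?thesis by simp
        next
          case False
          then have "1 / sqrt \<rho> \<le> 1" by simp
          then show ?thesis using \<rho> by (simp add: add_increasing2)
        qed
        with \<rho> show ?case by (simp flip: \<rho>_def)
      qed
    qed measurable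
    have "indep_var borel (\<lambda>\<omega>. 1 / sqrt \<bar>r * W \<omega>\<bar>) borel (\<lambda>\<omega>. 1 / sqrt \<bar>e \<bullet> U \<omega>\<bar>)"
      by (rule indep_var_of_vimage[OF ind0]) measurable
    from indep_var_integrable[OF this iW iU]
    show ?thesis by (simp add: Y_def abs_mult real_sqrt_mult)
  qed
  obtain A where A: "(norm m)\<^sup>2 < A" "A < 1"
    and sup: "(SUP z\<in>cball \<mu> Rm. ereal (lambda_max (Gamma_mat M X z)))
             < ereal ((1 - (norm m)\<^sup>2 / A) / (rstar + 3/2 * Rr))"
    using A3(2) unfolding m_def[symmetric] by blast
  have A0: "0 < A" using A(1) by (meson le_less_trans zero_le_power2)
  define q where "q = (1 - (norm m)\<^sup>2 / A) / (rstar + 3/2 * Rr)"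
  have q: "0 < q" unfolding q_def using A A0 rstar(2) A3(1) by (intro divide_pos_pos) auto
  \<comment> \<open>A real number strictly between the extended supremum and the bound of [A3] makes
    the coefficient \<open>c1\<close> strictly positive. The maximum with 0 meets the sign condition
    of the remainder bound and stays below \<open>q\<close>, which is positive.\<close>
  obtain L0 where L0: "(SUP z\<in>cball \<mu> Rm. ereal (lambda_max (Gamma_mat M X z))) < ereal L0" "ereal L0 < ereal q"
    using ereal_dense2[OF sup] unfolding q_def by blast
  define L where "L = max L0 0"
  have L: "0 \<le> L" "L < q" using L0(2) q by (auto simp: L_def)
  have lam: "lambda_max (Gamma_mat M X z) \<le> L" if "z \<in> cball \<mu> Rm" for z
  proof -
    have "ereal (lambda_max (Gamma_mat M X z)) \<le> (SUP z\<in>cball \<mu> Rm. ereal (lambda_max (Gamma_mat M X z)))"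
      using that by (rule SUP_upper)
    also have "\<dots> < ereal L0" by (rule L0(1))
    finally show ?thesis by (simp add: L_def)
  qed
  define c1 where "c1 = 1 - (norm m)\<^sup>2 / A - L * (rstar + 3/2 * Rr)"
  have c1: "c1 > 0"
  proof -
    have "0 < rstar + 3/2 * Rr" using rstar(2) A3(1) by simp
    then have "L * (rstar + 3/2 * Rr) < 1 - (norm m)\<^sup>2 / A"
      using L(2) unfolding q_def by (simp only: pos_less_divide_eq)
    then show ?thesis by (simp add: c1_def)
  qed
  show ?thesis
  proof (rule that)
    show "0 < min c1 (1 - A)" using c1 A by simp
    fix y :: "(real ^ 'n) \<times> real"
    assume y: "fst y \<in> cball \<mu> Rm" "0 \<le> snd y" "snd y \<le> rstar + Rr"
    define h a where "h = fst y - \<mu>" and "a = snd y"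
    have yh: "y = (\<mu> + h, a)" by (simp add: h_def a_def)
    have nh: "norm h \<le> Rm" using y(1) by (simp add: h_def dist_norm norm_minus_commute)
    have rem: "(\<integral>\<omega>. a * (norm_slope h (Y \<omega>) 1 - norm_slope h (Y \<omega>) 0)
      + \<beta> * (norm (Y \<omega> - h) - norm (Y \<omega>) - norm_slope h (Y \<omega>) 0) \<partial>M) \<le> (a + \<beta> / 2) * (L * (h \<bullet> h))"
      if \<beta>: "0 \<le> \<beta>" and h: "h \<noteq> 0" for \<beta>
    proof -
      obtain e where e: "norm e = 1" "e \<bullet> h = 0"
        using exists_unit_orthogonal[of h] dim by auto
      show ?thesis
      proof (rule expected_line_remainder_le[OF Y intn e h nz[OF e(1)] int[OF e(1)] _ \<beta> L(1)])
        show "0 \<le> a" using y by (simp add: a_def)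
        fix t :: real assume t: "t \<in> {0..1}" and i: "integrable M (\<lambda>\<omega>. 1 / norm (Y \<omega> - t *\<^sub>R h))"
        have XYt: "X \<omega> - (\<mu> + t *\<^sub>R h) = Y \<omega> - t *\<^sub>R h" for \<omega> by (simp add: XY)
        have "t * norm h \<le> 1 * norm h" by (rule mult_right_mono) (use t in auto)
        then have z: "\<mu> + t *\<^sub>R h \<in> cball \<mu> Rm" using t nh by (simp add: dist_norm)
        have i': "integrable M (\<lambda>\<omega>. 1 / norm (X \<omega> - (\<mu> + t *\<^sub>R h)))" using i by (simp only: XYt)
        have Xm: "X \<in> borel_measurable M" unfolding X by measurable
        have "(\<integral>\<omega>. norm_hessian h (Y \<omega> - t *\<^sub>R h) \<partial>M)
            \<le> lambda_max (Gamma_mat M X (\<mu> + t *\<^sub>R h)) * (h \<bullet> h)"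
          using Gamma_mat_quadratic_le(2)[OF Xm i', of h] by (simp only: XYt)
        also have "\<dots> \<le> L * (h \<bullet> h)" by (intro mult_right_mono lam z) simp
        finally show "integrable M (\<lambda>\<omega>. norm_hessian h (Y \<omega> - t *\<^sub>R h)) \<and>
            (\<integral>\<omega>. norm_hessian h (Y \<omega> - t *\<^sub>R h) \<partial>M) \<le> L * (h \<bullet> h)"
          using Gamma_mat_quadratic_le(1)[OF Xm i', of h] by (simp only: XYt)
      qed
    qed
    have "min c1 (1 - A) * (norm (y - (\<mu>, rstar)))\<^sup>2 = min c1 (1 - A) * (norm h)\<^sup>2 + min c1 (1 - A) * (a - rstar)\<^sup>2"
      by (simp add: yh norm_Pair distrib_left)
    also have "\<dots> \<le> c1 * (norm h)\<^sup>2 + (1 - A) * (a - rstar)\<^sup>2"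
      by (intro add_mono mult_right_mono) auto
    also have "\<dots> \<le> (\<integral>\<omega>. grad_g (\<mu> + Y \<omega>) (\<mu> + h, a) \<bullet> (h, a - rstar) \<partial>M)"
      unfolding c1_def
      by (rule expected_gradient_coercive[OF Y intY Y0 EY EN EU rem])
        (use y L A3(1) A0 in \<open>auto simp: a_def\<close>)
    also have "\<dots> = (\<integral>\<omega>. grad_g (X \<omega>) y \<bullet> (y - (\<mu>, rstar)) \<partial>M)"
      by (simp add: XY yh)
    finally show "min c1 (1 - A) * (norm (y - (\<mu>, rstar)))\<^sup>2 \<le> (\<integral>\<omega>. grad_g (X \<omega>) y \<bullet> (y - (\<mu>, rstar)) \<partial>M)" .
  qed
qed

subsection \<open>Almost sure convergence from a drift condition\<close>

text \<open>\<open>A\<close> decreases to some limit \<open>l\<close>. If \<open>l\<close> were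
  positive, then eventually \<open>s n < l / 2\<close>, hence \<open>v n \<ge> l / 2\<close>, and
  every further step would lower \<open>A\<close> by at least
  \<open>c * \<gamma> n * (l / 2)\<close>; as these amounts have infinite sum, \<open>A\<close>
  would become negative.\<close>

lemma decreasing_by_divergent_steps_tendsto_0:
  fixes A v s \<gamma> :: "nat \<Rightarrow> real"
  assumes A: "\<And>n. A n = v n + s n" and v: "\<And>n. 0 \<le> v n" and \<gamma>: "\<And>n. 0 \<le> \<gamma> n" and c: "0 < c"
    and s0: "\<And>n. 0 \<le> s n" and s: "s \<longlonglongrightarrow> 0"
    and dec: "\<And>n. A (Suc n) + c * \<gamma> n * v n \<le> A n"
    and div: "filterlim (\<lambda>N. \<Sum>n<N. \<gamma> n) at_top sequentially"
  shows "A \<longlonglongrightarrow> 0"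
proof -
  have A0: "0 \<le> A n" for n using v s0 by (simp add: A)
  have "decseq A"
    by (rule decseq_SucI) (use dec v \<gamma> c in \<open>smt (verit) mult_nonneg_nonneg\<close>)
  then obtain l where l: "A \<longlonglongrightarrow> l" and lA: "\<And>n. l \<le> A n"
    using decseq_convergent[of A 0] A0 by metis
  have "l \<ge> 0" using l A0 by (intro LIMSEQ_le_const) auto
  moreover have "\<not> l > 0"
  proof
    assume lpos: "l > 0"
    have "eventually (\<lambda>n. s n < l / 2) sequentially"
      using s lpos by (intro order_tendstoD) auto
    then obtain N where N: "\<And>n. n \<ge> N \<Longrightarrow> s n < l / 2" by (auto simp: eventually_sequentially)
    have vn: "l / 2 \<le> v n" if "n \<ge> N" for n using N[OF that] lA[of n] by (simp add: A)
    define d where "d = c * (l / 2)"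
    have d: "d > 0" using c lpos by (simp add: d_def)
    have bound: "A n + d * (\<Sum>k=N..<n. \<gamma> k) \<le> A N" if "n \<ge> N" for n
      using that
    proof (induction n rule: dec_induct)
      case (step n)
      have "c * \<gamma> n * (l / 2) \<le> c * \<gamma> n * v n"
        using vn[OF step(1)] c \<gamma>[of n] by (intro mult_left_mono) auto
      then have "A (Suc n) + d * \<gamma> n \<le> A n" using dec[of n] by (simp add: d_def mult_ac)
      with step show ?case by (simp add: distrib_left)
    qed simp
    have "eventually (\<lambda>n. (\<Sum>k<n. \<gamma> k) > A N / d + (\<Sum>k<N. \<gamma> k)) sequentially"
      using div by (simp add: filterlim_at_top_dense)
    then have "eventually (\<lambda>n. (\<Sum>k<n. \<gamma> k) > A N / d + (\<Sum>k<N. \<gamma> k) \<and> n \<ge> N) sequentially"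
      by (intro eventually_conj eventually_ge_at_top)
    then obtain n where n: "(\<Sum>k<n. \<gamma> k) > A N / d + (\<Sum>k<N. \<gamma> k)" "n \<ge> N"
      by (auto simp: eventually_sequentially)
    have "(\<Sum>k<n. \<gamma> k) = (\<Sum>k<N. \<gamma> k) + (\<Sum>k=N..<n. \<gamma> k)"
      using n(2) by (simp add: lessThan_atLeast0 sum.atLeastLessThan_concat)
    with n have "A N / d < (\<Sum>k=N..<n. \<gamma> k)" by simp
    then have "A N < d * (\<Sum>k=N..<n. \<gamma> k)" using d by (simp add: pos_divide_less_eq mult.commute)
    with bound[OF n(2)] A0[of n] show False by simp
  qed
  ultimately have "l = 0" by simp
  with l show ?thesis by simp
qed

text \<open>With \<open>s\<close> the tail sums of \<open>C \<gamma>\<^sup>2\<close>, the process \<open>V + s\<close> is a nonnegative supermartingale whose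
  expectation tends to 0; the maximal inequality turns this into almost sure convergence. The drift
  condition is only needed on the events on which \<open>V\<close> has stayed below a curve.\<close>
lemma (in prob_space) AE_tendsto_0_of_drift:
  fixes V :: "nat \<Rightarrow> 'a \<Rightarrow> real" and \<gamma> :: "nat \<Rightarrow> real"
  assumes intV: "\<And>n. integrable M (V n)" and V0: "\<And>n \<omega>. \<omega> \<in> space M \<Longrightarrow> 0 \<le> V n \<omega>"
    and c: "0 < c" and C: "0 \<le> C" and \<gamma>: "\<And>n. 0 \<le> \<gamma> n"
    and div: "filterlim (\<lambda>N. \<Sum>n<N. \<gamma> n) at_top sequentially"
    and sq: "summable (\<lambda>n. (\<gamma> n)\<^sup>2)"
    and drift: "\<And>m n u B. B = {\<omega> \<in> space M. \<forall>k\<in>{m..n}. V k \<omega> < u k} \<Longrightarrow>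
      (\<integral>\<omega>. V (Suc n) \<omega> * indicator B \<omega> \<partial>M) + c * \<gamma> n * (\<integral>\<omega>. V n \<omega> * indicator B \<omega> \<partial>M)
        \<le> (\<integral>\<omega>. V n \<omega> * indicator B \<omega> \<partial>M) + C * (\<gamma> n)\<^sup>2 * prob B"
  shows "AE \<omega> in M. (\<lambda>n. V n \<omega>) \<longlonglongrightarrow> 0"
proof -
  have [measurable]: "V n \<in> borel_measurable M" for n using intV by auto
  define s where "s n = C * ((\<Sum>k. (\<gamma> k)\<^sup>2) - (\<Sum>k<n. (\<gamma> k)\<^sup>2))" for n
  have s0: "0 \<le> s n" for n
    unfolding s_def using C sum_le_suminf[OF sq, of "{..<n}"] by simp
  have sS: "s n = s (Suc n) + C * (\<gamma> n)\<^sup>2" for n by (simp add: s_def algebra_simps)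
  have slim: "s \<longlonglongrightarrow> 0"
  proof -
    have "s \<longlonglongrightarrow> C * ((\<Sum>k. (\<gamma> k)\<^sup>2) - (\<Sum>k. (\<gamma> k)\<^sup>2))"
      unfolding s_def by (intro tendsto_intros summable_LIMSEQ sq)
    then show ?thesis by simp
  qed
  have inti: "integrable M (\<lambda>\<omega>. V n \<omega> * indicator B \<omega>)" if "B \<in> events" for n B
    using integrable_mult_indicator[OF that intV[of n]] by (simp add: mult.commute)
  define A where "A n = (\<integral>\<omega>. V n \<omega> \<partial>M) + s n" for n
  have Alim: "A \<longlonglongrightarrow> 0"
  proof (rule decreasing_by_divergent_steps_tendsto_0[OF _ _ \<gamma> c s0 slim _ div])
    show "A n = (\<integral>\<omega>. V n \<omega> \<partial>M) + s n" for n by (simp add: A_def)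
    show "0 \<le> (\<integral>\<omega>. V n \<omega> \<partial>M)" for n by (rule Bochner_Integration.integral_nonneg) (rule V0)
    fix n
    have whole: "(\<integral>\<omega>. V k \<omega> * indicator (space M) \<omega> \<partial>M) = (\<integral>\<omega>. V k \<omega> \<partial>M)" for k
      by (intro Bochner_Integration.integral_cong) auto
    \<comment> \<open>The index range is empty, so the condition is vacuous and the drift inequality
      is read on the whole space.\<close>
    have "space M = {\<omega> \<in> space M. \<forall>k\<in>{Suc n..n}. V k \<omega> < 0}" by auto
    from drift[OF this] show "A (Suc n) + c * \<gamma> n * (\<integral>\<omega>. V n \<omega> \<partial>M) \<le> A n"
      using sS[of n] by (simp add: whole A_def prob_space)
  qed
  \<comment> \<open>\<open>B'\<close> is the part of \<open>B\<close> on which level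
    \<open>\<epsilon>\<close> is not reached at time \<open>n\<close>. On the rest
    \<open>V n + s n\<close> is at least \<open>\<epsilon>\<close>, so its mean there is at least
    \<open>\<epsilon>\<close> times the probability.\<close>
  have cut: "\<epsilon> * (prob B - prob B') + (\<integral>\<omega>. V n \<omega> * indicator B' \<omega> \<partial>M) + s n * prob B'
      \<le> (\<integral>\<omega>. V n \<omega> * indicator B \<omega> \<partial>M) + s n * prob B"
    if B: "B \<in> events" and B': "B' = {\<omega> \<in> B. V n \<omega> < \<epsilon> - s n}" for n \<epsilon> B B'
  proof -
    have B'm: "B' \<in> events" and sub: "B' \<subseteq> B"
    proof -
      have "B' = B \<inter> {\<omega> \<in> space M. V n \<omega> < \<epsilon> - s n}" using sets.sets_into_space[OF B] by (auto simp: B')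
      also have "\<dots> \<in> events" using B by measurable
      finally show "B' \<in> events" .
    qed (auto simp: B')
    have "(\<epsilon> - s n) * prob (B - B') = (\<integral>\<omega>. (\<epsilon> - s n) * indicator (B - B') \<omega> \<partial>M)"
      using B B'm sets.sets_into_space[OF B] by (simp add: Int_absorb2 Int_absorb1)
    also have "\<dots> \<le> (\<integral>\<omega>. V n \<omega> * indicator (B - B') \<omega> \<partial>M)"
    proof (rule integral_mono)
      show "integrable M (\<lambda>\<omega>. (\<epsilon> - s n) * indicator (B - B') \<omega>)"
        using B B'm by (intro integrable_mult_right integrable_real_indicator) (auto simp: less_top[symmetric])
      show "integrable M (\<lambda>\<omega>. V n \<omega> * indicator (B - B') \<omega>)" using B B'm by (intro inti) auto
    qed (auto simp: B' indicator_def)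
    also have "\<dots> = (\<integral>\<omega>. V n \<omega> * indicator B \<omega> - V n \<omega> * indicator B' \<omega> \<partial>M)"
      using sub by (intro Bochner_Integration.integral_cong) (auto simp: indicator_def)
    also have "\<dots> = (\<integral>\<omega>. V n \<omega> * indicator B \<omega> \<partial>M) - (\<integral>\<omega>. V n \<omega> * indicator B' \<omega> \<partial>M)"
      using B B'm by (intro Bochner_Integration.integral_diff inti)
    finally show ?thesis using finite_measure_Diff[OF B B'm sub] by (simp add: algebra_simps)
  qed
  have event: "AE \<omega> in M. \<exists>m. \<forall>k\<ge>m. V k \<omega> < \<epsilon> - s k" if \<epsilon>: "0 < \<epsilon>" for \<epsilon>
  proof -
    define B where "B m n = {\<omega> \<in> space M. \<forall>k\<in>{m..n}. V k \<omega> < \<epsilon> - s k}" for m n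
    have Bm[measurable]: "B m n \<in> events" for m n unfolding B_def by measurable
    \<comment> \<open>The left side is at most the mean of \<open>V + s\<close> stopped when it
      first reaches \<open>\<epsilon>\<close> after time \<open>m\<close>, with every stopped path
      counted as \<open>\<epsilon>\<close>. The induction alternates the drift inequality on paths
      still running with \<open>cut\<close>.\<close>
    have maximal: "\<epsilon> * (1 - prob (B m n)) + (\<integral>\<omega>. V n \<omega> * indicator (B m n) \<omega> \<partial>M) + s n * prob (B m n) \<le> A m"
      if "m \<le> n" for m n
      using that
    proof (induction n rule: dec_induct)
      case base
      have "B m m = {\<omega> \<in> space M. V m \<omega> < \<epsilon> - s m}" by (auto simp: B_def)
      from cut[OF _ this] have "\<epsilon> * (1 - prob (B m m)) + (\<integral>\<omega>. V m \<omega> * indicator (B m m) \<omega> \<partial>M) + s m * prob (B m m)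
          \<le> (\<integral>\<omega>. V m \<omega> * indicator (space M) \<omega> \<partial>M) + s m" by (simp add: prob_space)
      also have "(\<integral>\<omega>. V m \<omega> * indicator (space M) \<omega> \<partial>M) = (\<integral>\<omega>. V m \<omega> \<partial>M)"
        by (intro Bochner_Integration.integral_cong) auto
      finally show ?case by (simp add: A_def)
    next
      case (step n)
      have "B m (Suc n) = {\<omega> \<in> B m n. V (Suc n) \<omega> < \<epsilon> - s (Suc n)}"
        using step by (auto simp: B_def le_Suc_eq)
      from cut[OF Bm this]
      have 1: "\<epsilon> * (prob (B m n) - prob (B m (Suc n))) + (\<integral>\<omega>. V (Suc n) \<omega> * indicator (B m (Suc n)) \<omega> \<partial>M)
          + s (Suc n) * prob (B m (Suc n))
        \<le> (\<integral>\<omega>. V (Suc n) \<omega> * indicator (B m n) \<omega> \<partial>M) + s (Suc n) * prob (B m n)" .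
      have "0 \<le> c * \<gamma> n * (\<integral>\<omega>. V n \<omega> * indicator (B m n) \<omega> \<partial>M)"
        using c \<gamma> V0 by (intro mult_nonneg_nonneg Bochner_Integration.integral_nonneg) auto
      with drift[OF B_def[of m n]]
      have "(\<integral>\<omega>. V (Suc n) \<omega> * indicator (B m n) \<omega> \<partial>M)
        \<le> (\<integral>\<omega>. V n \<omega> * indicator (B m n) \<omega> \<partial>M) + C * (\<gamma> n)\<^sup>2 * prob (B m n)" by linarith
      with 1 step.IH sS[of n] show ?case by (simp add: algebra_simps)
    qed
    define E where "E m = {\<omega> \<in> space M. \<forall>k\<ge>m. V k \<omega> < \<epsilon> - s k}" for m
    have E: "E m = (\<Inter>n. B m n)" for m
      unfolding E_def B_def by auto (meson atLeastAtMost_iff order_refl)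
    have Em[measurable]: "E m \<in> events" for m unfolding E_def by measurable
    have PE: "1 - A m / \<epsilon> \<le> prob (E m)" for m
    proof -
      have "(\<lambda>n. prob (B m n)) \<longlonglongrightarrow> prob (E m)"
        unfolding E by (rule finite_Lim_measure_decseq) (auto simp: decseq_def B_def)
      moreover have "1 - A m / \<epsilon> \<le> prob (B m n)" if "m \<le> n" for n
      proof -
        have "0 \<le> (\<integral>\<omega>. V n \<omega> * indicator (B m n) \<omega> \<partial>M) + s n * prob (B m n)"
          using s0 V0 by (intro add_nonneg_nonneg mult_nonneg_nonneg Bochner_Integration.integral_nonneg) auto
        with maximal[OF that] have "\<epsilon> * (1 - prob (B m n)) \<le> A m" by linarith
        then have "1 - prob (B m n) \<le> A m / \<epsilon>" using \<epsilon> by (simp add: pos_le_divide_eq mult.commute)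
        then show ?thesis by simp
      qed
      ultimately show ?thesis by (intro LIMSEQ_le_const) auto
    qed
    \<comment> \<open>Starting later makes the bound on the probability of ever reaching
      \<open>\<epsilon>\<close> arbitrarily small, since \<open>A m\<close> tends to 0.\<close>
    have "(\<lambda>m. 1 - A m / \<epsilon>) \<longlonglongrightarrow> 1 - 0 / \<epsilon>"
      by (intro tendsto_intros Alim) (use \<epsilon> in simp)
    moreover have "1 - A m / \<epsilon> \<le> prob (\<Union>m. E m)" for m
      using PE[of m] finite_measure_mono[of "E m" "\<Union>m. E m"] by fastforce
    ultimately have "1 \<le> prob (\<Union>m. E m)" by (intro LIMSEQ_le_const2) auto
    then have "prob (\<Union>m. E m) = 1" using prob_le_1 antisym by blast
    then have "AE \<omega> in M. \<omega> \<in> (\<Union>m. E m)" by (subst AE_in_set_eq_1) auto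
    then show ?thesis by eventually_elim (auto simp: E_def)
  qed
  have "AE \<omega> in M. \<forall>j::nat. \<exists>m. \<forall>k\<ge>m. V k \<omega> < 1 / real (Suc j) - s k"
    by (subst AE_all_countable) (auto intro!: event)
  then show ?thesis
  proof (rule AE_mp[OF _ AE_I2], intro impI)
    fix \<omega> assume \<omega>: "\<omega> \<in> space M" and ev: "\<forall>j::nat. \<exists>m. \<forall>k\<ge>m. V k \<omega> < 1 / real (Suc j) - s k"
    show "(\<lambda>n. V n \<omega>) \<longlonglongrightarrow> 0"
    proof (rule LIMSEQ_I)
      fix \<epsilon> :: real assume "0 < \<epsilon>"
      then obtain j where j: "1 / real (Suc j) < \<epsilon>" using nat_approx_posE by blast
      from ev obtain m where m: "\<And>k. k \<ge> m \<Longrightarrow> V k \<omega> < 1 / real (Suc j) - s k" by blast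
      have "norm (V k \<omega> - 0) < \<epsilon>" if "k \<ge> m" for k
        using m[OF that] j s0[of k] V0[OF \<omega>, of k] by simp
      then show "\<exists>m. \<forall>k\<ge>m. norm (V k \<omega> - 0) < \<epsilon>" by blast
    qed
  qed
qed

subsection \<open>The projected algorithm\<close>

lemma grad_g_measurable [measurable]:
  fixes f :: "'p \<Rightarrow> 'a::euclidean_space"
  assumes [measurable]: "f \<in> borel_measurable M" "y \<in> borel_measurable M"
  shows "(\<lambda>\<omega>. grad_g (f \<omega>) (y \<omega>)) \<in> borel_measurable M"
proof -
  have [measurable]: "(\<lambda>\<omega>. fst (y \<omega>)) \<in> borel_measurable M" "(\<lambda>\<omega>. snd (y \<omega>)) \<in> borel_measurable M"
    using assms(2) by (auto intro!: measurable_compose[OF assms(2)] borel_measurable_continuous_onI continuous_intros)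
  have "(\<lambda>\<omega>. grad_g (f \<omega>) (y \<omega>)) = (\<lambda>\<omega>. (fst (y \<omega>) - f \<omega> -
      (snd (y \<omega>) / norm (fst (y \<omega>) - f \<omega>)) *\<^sub>R (fst (y \<omega>) - f \<omega>), snd (y \<omega>) - norm (fst (y \<omega>) - f \<omega>)))"
    by (auto simp: grad_g_def split: prod.split)
  also have "\<dots> \<in> borel_measurable M" by measurable
  finally show ?thesis .
qed

text \<open>The unit vector in the gradient causes no blow-up: both components have norm at most
  \<open>\<bar>n - a\<bar>\<close> with \<open>n = norm (z - x)\<close>, also for
  \<open>x = z\<close>, where the first one is 0.\<close>

lemma norm_grad_g_le:
  fixes x \<mu> :: "'a::euclidean_space"
  shows "(norm (grad_g x (z, a)))\<^sup>2 \<le> 8 * (norm (x - \<mu>))\<^sup>2 + 8 * (norm (z - \<mu>))\<^sup>2 + 4 * a\<^sup>2"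
proof -
  define n where "n = norm (z - x)"
  have "norm (z - x - (a / n) *\<^sub>R (z - x)) \<le> \<bar>n - a\<bar>"
  proof (cases "n = 0")
    case False
    have "z - x - (a / n) *\<^sub>R (z - x) = (1 - a / n) *\<^sub>R (z - x)" by (simp add: scaleR_left_diff_distrib)
    then have "norm (z - x - (a / n) *\<^sub>R (z - x)) = \<bar>(1 - a / n) * n\<bar>" by (simp add: n_def abs_mult)
    also have "(1 - a / n) * n = n - a" using False by (simp add: left_diff_distrib)
    finally show ?thesis by simp
  qed (simp add: n_def)
  then have "(norm (z - x - (a / n) *\<^sub>R (z - x)))\<^sup>2 \<le> (n - a)\<^sup>2"
    by (metis abs_le_square_iff abs_norm_cancel)
  then have "(norm (grad_g x (z, a)))\<^sup>2 \<le> 2 * (n - a)\<^sup>2"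
    by (simp add: grad_g_def norm_Pair n_def power2_commute)
  also have "\<dots> \<le> 4 * n\<^sup>2 + 4 * a\<^sup>2"
    using zero_le_power2[of "n + a"] by (simp add: power2_eq_square algebra_simps)
  also have "4 * n\<^sup>2 \<le> 8 * (norm (x - \<mu>))\<^sup>2 + 8 * (norm (z - \<mu>))\<^sup>2"
  proof -
    have "n \<le> norm (x - \<mu>) + norm (z - \<mu>)"
      unfolding n_def using norm_triangle_ineq4[of "z - \<mu>" "x - \<mu>"] by simp
    then have "n\<^sup>2 \<le> (norm (x - \<mu>) + norm (z - \<mu>))\<^sup>2" by (rule power_mono) (simp add: n_def)
    also have "\<dots> \<le> 2 * (norm (x - \<mu>))\<^sup>2 + 2 * (norm (z - \<mu>))\<^sup>2"
      using sum_squares_bound[of "norm (x - \<mu>)" "norm (z - \<mu>)"] by (simp add: power2_sum)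
    finally show ?thesis by simp
  qed
  finally show ?thesis by simp
qed

text \<open>Since \<open>\<pi>\<close> is nonexpansive and fixes \<open>\<theta>\<close>, projecting
  does not increase the distance to \<open>\<theta>\<close>. Expand the square of the unprojected
  step: coercivity handles the cross term, and the quadratic growth of the squared gradient with
  [A2] the last one.\<close>

lemma (in prob_space) expected_projected_step_le:
  fixes X :: "'a \<Rightarrow> 'b::euclidean_space" and \<pi> :: "'b \<times> real \<Rightarrow> 'b \<times> real"
  assumes X[measurable]: "X \<in> borel_measurable M"
    and A2: "integrable M (\<lambda>\<omega>. (norm (X \<omega> - \<mu>))\<^sup>2)"
    and \<pi>: "\<And>y y'. norm (\<pi> y - \<pi> y') \<le> norm (y - y')" "\<pi> \<theta> = \<theta>"
    and y: "norm (fst y - \<mu>) \<le> R" "\<bar>snd y\<bar> \<le> R'"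
    and coercive: "c * (norm (y - \<theta>))\<^sup>2 \<le> (\<integral>\<omega>. grad_g (X \<omega>) y \<bullet> (y - \<theta>) \<partial>M)"
    and \<gamma>: "0 \<le> \<gamma>"
  shows "(\<integral>\<omega>. (norm (\<pi> (y - \<gamma> *\<^sub>R grad_g (X \<omega>) y) - \<theta>))\<^sup>2 \<partial>M)
    \<le> (norm (y - \<theta>))\<^sup>2 - 2 * \<gamma> * c * (norm (y - \<theta>))\<^sup>2
      + (8 * (\<integral>\<omega>. (norm (X \<omega> - \<mu>))\<^sup>2 \<partial>M) + 8 * R\<^sup>2 + 4 * R'\<^sup>2) * \<gamma>\<^sup>2"
proof -
  let ?G = "\<lambda>\<omega>. grad_g (X \<omega>) y"
  let ?b = "\<lambda>\<omega>. 8 * (norm (X \<omega> - \<mu>))\<^sup>2 + 8 * R\<^sup>2 + 4 * R'\<^sup>2"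
  have G[measurable]: "?G \<in> borel_measurable M" by measurable
  have le: "(norm (?G \<omega>))\<^sup>2 \<le> ?b \<omega>" for \<omega>
  proof -
    have "(norm (?G \<omega>))\<^sup>2 \<le> 8 * (norm (X \<omega> - \<mu>))\<^sup>2 + 8 * (norm (fst y - \<mu>))\<^sup>2 + 4 * (snd y)\<^sup>2"
      using norm_grad_g_le[of "X \<omega>" "fst y" "snd y" \<mu>] by simp
    moreover have "(norm (fst y - \<mu>))\<^sup>2 \<le> R\<^sup>2" by (rule power_mono) (use y in auto)
    moreover have "(snd y)\<^sup>2 \<le> R'\<^sup>2" using y(2) by (metis abs_ge_zero power2_abs power_mono)
    ultimately show ?thesis by linarith
  qed
  have intb: "integrable M ?b" using A2 by simp
  have intG2: "integrable M (\<lambda>\<omega>. (norm (?G \<omega>))\<^sup>2)"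
    by (rule Bochner_Integration.integrable_bound[OF intb])
      (use le in \<open>auto intro!: AE_I2 intro: order_trans[OF _ abs_ge_self]\<close>)
  have intG: "integrable M ?G"
  proof (rule Bochner_Integration.integrable_bound)
    show "integrable M (\<lambda>\<omega>. 1 + (norm (?G \<omega>))\<^sup>2)" using intG2 by simp
    have "norm (?G \<omega>) \<le> 1 + (norm (?G \<omega>))\<^sup>2" for \<omega>
      using sum_squares_bound[of 1 "norm (?G \<omega>)"] norm_ge_zero[of "?G \<omega>"] by (simp del: norm_ge_zero)
    then show "AE \<omega> in M. norm (?G \<omega>) \<le> norm (1 + (norm (?G \<omega>))\<^sup>2)"
      by (intro AE_I2) (auto intro: order_trans[OF _ abs_ge_self])
  qed measurable
  have int: "integrable M (\<lambda>\<omega>. ?G \<omega> \<bullet> (y - \<theta>))" using intG by simp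
  have step: "(norm (\<pi> (y - \<gamma> *\<^sub>R ?G \<omega>) - \<theta>))\<^sup>2
      \<le> (norm (y - \<theta>))\<^sup>2 - 2 * \<gamma> * (?G \<omega> \<bullet> (y - \<theta>)) + \<gamma>\<^sup>2 * (norm (?G \<omega>))\<^sup>2" for \<omega>
  proof -
    have "norm (\<pi> (y - \<gamma> *\<^sub>R ?G \<omega>) - \<theta>) \<le> norm (y - \<gamma> *\<^sub>R ?G \<omega> - \<theta>)"
      using \<pi>(1)[of "y - \<gamma> *\<^sub>R ?G \<omega>" \<theta>] by (simp add: \<pi>(2))
    then have "(norm (\<pi> (y - \<gamma> *\<^sub>R ?G \<omega>) - \<theta>))\<^sup>2 \<le> (norm ((y - \<theta>) - \<gamma> *\<^sub>R ?G \<omega>))\<^sup>2"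
      by (intro power_mono) (auto simp: algebra_simps)
    also have "\<dots> = (norm (y - \<theta>))\<^sup>2 - 2 * \<gamma> * (?G \<omega> \<bullet> (y - \<theta>)) + \<gamma>\<^sup>2 * (norm (?G \<omega>))\<^sup>2"
    proof -
      have "(norm (u - \<gamma> *\<^sub>R w))\<^sup>2 = (norm u)\<^sup>2 - 2 * \<gamma> * (w \<bullet> u) + \<gamma>\<^sup>2 * (norm w)\<^sup>2" for u w :: "'b \<times> real"
        unfolding power2_norm_eq_inner
        by (simp add: inner_diff_left inner_diff_right inner_commute power2_eq_square algebra_simps)
      then show ?thesis .
    qed
    finally show ?thesis .
  qed
  have "(\<integral>\<omega>. (norm (\<pi> (y - \<gamma> *\<^sub>R ?G \<omega>) - \<theta>))\<^sup>2 \<partial>M)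
    \<le> (\<integral>\<omega>. (norm (y - \<theta>))\<^sup>2 - 2 * \<gamma> * (?G \<omega> \<bullet> (y - \<theta>)) + \<gamma>\<^sup>2 * ?b \<omega> \<partial>M)"
  proof (rule integral_mono')
    show "integrable M (\<lambda>\<omega>. (norm (y - \<theta>))\<^sup>2 - 2 * \<gamma> * (?G \<omega> \<bullet> (y - \<theta>)) + \<gamma>\<^sup>2 * ?b \<omega>)"
      using int A2 by (intro Bochner_Integration.integrable_add Bochner_Integration.integrable_diff integrable_mult_right) auto
    have "\<gamma>\<^sup>2 * (norm (?G \<omega>))\<^sup>2 \<le> \<gamma>\<^sup>2 * ?b \<omega>" for \<omega> by (rule mult_left_mono[OF le]) simp
    then show le': "(norm (\<pi> (y - \<gamma> *\<^sub>R ?G \<omega>) - \<theta>))\<^sup>2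
      \<le> (norm (y - \<theta>))\<^sup>2 - 2 * \<gamma> * (?G \<omega> \<bullet> (y - \<theta>)) + \<gamma>\<^sup>2 * ?b \<omega>" for \<omega>
      using step[of \<omega>] by (meson add_left_mono order_trans)
    show "0 \<le> (norm (y - \<theta>))\<^sup>2 - 2 * \<gamma> * (?G \<omega> \<bullet> (y - \<theta>)) + \<gamma>\<^sup>2 * ?b \<omega>" for \<omega>
      using order_trans[OF zero_le_power2 le'] .
  qed
  also have "\<dots> = (norm (y - \<theta>))\<^sup>2 - 2 * \<gamma> * (\<integral>\<omega>. ?G \<omega> \<bullet> (y - \<theta>) \<partial>M) + \<gamma>\<^sup>2 * (\<integral>\<omega>. ?b \<omega> \<partial>M)"
    using int intb A2 by (simp add: prob_space)
  also have "(\<integral>\<omega>. ?b \<omega> \<partial>M) = 8 * (\<integral>\<omega>. (norm (X \<omega> - \<mu>))\<^sup>2 \<partial>M) + 8 * R\<^sup>2 + 4 * R'\<^sup>2"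
    using A2 by (simp add: prob_space)
  finally show ?thesis
    using mult_left_mono[OF coercive, of "2 * \<gamma>"] \<gamma> by (simp add: mult_ac)
qed

section \<open>Past and fresh observations\<close>

text \<open>This plays the part of conditioning on the past \<open>T\<close>: by independence the
  joint law is a product, so Fubini allows \<open>T\<close> to be frozen at \<open>t\<close> while
  the fresh observation \<open>Y\<close> is averaged.\<close>

lemma (in prob_space) integral_le_of_indep_var:
  fixes F :: "'t \<times> 't \<Rightarrow> real"
  assumes ind: "indep_var N T N' Y"
    and F[measurable]: "F \<in> borel_measurable (N \<Otimes>\<^sub>M N')" and bound: "\<And>z. \<bar>F z\<bar> \<le> D"
    and G[measurable]: "G \<in> borel_measurable N" and intG: "integrable M (\<lambda>\<omega>. G (T \<omega>))"
    and le: "\<And>t. t \<in> space N \<Longrightarrow> (\<integral>\<omega>. F (t, Y \<omega>) \<partial>M) \<le> G t"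
  shows "(\<integral>\<omega>. F (T \<omega>, Y \<omega>) \<partial>M) \<le> (\<integral>\<omega>. G (T \<omega>) \<partial>M)"
proof -
  have T[measurable]: "T \<in> M \<rightarrow>\<^sub>M N" and Y[measurable]: "Y \<in> M \<rightarrow>\<^sub>M N'"
    and eq: "distr M N T \<Otimes>\<^sub>M distr M N' Y = distr M (N \<Otimes>\<^sub>M N') (\<lambda>\<omega>. (T \<omega>, Y \<omega>))"
    using ind unfolding indep_var_distribution_eq by auto
  interpret T: prob_space "distr M N T" by (rule prob_space_distr) measurable
  interpret Y: prob_space "distr M N' Y" by (rule prob_space_distr) measurable
  interpret TY: pair_prob_space "distr M N T" "distr M N' Y" ..
  have F': "F \<in> borel_measurable (distr M N T \<Otimes>\<^sub>M distr M N' Y)" by measurable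
  have intF: "integrable (distr M N T \<Otimes>\<^sub>M distr M N' Y) F"
    by (rule TY.integrable_const_bound[of _ D]) (use bound F' in auto)
  have "(\<integral>\<omega>. F (T \<omega>, Y \<omega>) \<partial>M) = (\<integral>z. F z \<partial>(distr M N T \<Otimes>\<^sub>M distr M N' Y))"
    unfolding eq by (subst integral_distr) auto
  also have "\<dots> = (\<integral>t. (\<integral>x. F (t, x) \<partial>distr M N' Y) \<partial>distr M N T)"
    by (rule TY.integral_fst'[OF intF, symmetric])
  also have "\<dots> \<le> (\<integral>t. G t \<partial>distr M N T)"
  proof (rule integral_mono)
    show "integrable (distr M N T) (\<lambda>t. \<integral>x. F (t, x) \<partial>distr M N' Y)" by (rule TY.integrable_fst'[OF intF])
    show "integrable (distr M N T) G" using intG by (subst integrable_distr_eq) auto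
    fix t assume "t \<in> space (distr M N T)"
    then have t: "t \<in> space N" by simp
    have "(\<integral>x. F (t, x) \<partial>distr M N' Y) = (\<integral>\<omega>. F (t, Y \<omega>) \<partial>M)"
      by (rule integral_distr) (use t in measurable)
    with le[OF t] show "(\<integral>x. F (t, x) \<partial>distr M N' Y) \<le> G t" by simp
  qed
  also have "\<dots> = (\<integral>\<omega>. G (T \<omega>) \<partial>M)" by (rule integral_distr) measurable
  finally show ?thesis .
qed

text \<open>The index is shifted: \<open>projected_iterate \<pi> \<gamma> y k\<close> is the iterate number \<open>k + 1\<close>, as a function of
  the whole sequence of observations, of which it only uses those numbered \<open>2, \<dots>, k + 1\<close>.\<close>
primrec projected_iterate ::
  "('a::euclidean_space \<times> real \<Rightarrow> 'a \<times> real) \<Rightarrow> (nat \<Rightarrow> real) \<Rightarrow> 'a \<times> real \<Rightarrow> nat \<Rightarrow> (nat \<Rightarrow> 'a) \<Rightarrow> 'a \<times> real"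
where
  "projected_iterate \<pi> \<gamma> y 0 x = y"
| "projected_iterate \<pi> \<gamma> y (Suc k) x =
    \<pi> (projected_iterate \<pi> \<gamma> y k x - \<gamma> (Suc k) *\<^sub>R grad_g (x (Suc (Suc k))) (projected_iterate \<pi> \<gamma> y k x))"

lemma projected_iterate_restrict:
  "k < n \<Longrightarrow> projected_iterate \<pi> \<gamma> y k (restrict x {1..n}) = projected_iterate \<pi> \<gamma> y k x"
  by (induction k) auto

lemma projected_iterate_measurable:
  assumes [measurable]: "\<pi> \<in> borel_measurable borel" and "k < n"
  shows "projected_iterate \<pi> \<gamma> y k \<in> borel_measurable (PiM {1..n} (\<lambda>_. borel))"
  using assms(2)
proof (induction k)
  case (Suc k)
  then have [measurable]: "projected_iterate \<pi> \<gamma> y k \<in> borel_measurable (PiM {1..n} (\<lambda>_. borel))" by simp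
  have [measurable]: "(\<lambda>x. x (Suc (Suc k))) \<in> borel_measurable (PiM {1..n} (\<lambda>_. borel))"
    using Suc.prems by (intro measurable_component_singleton) auto
  show ?case unfolding projected_iterate.simps by measurable
next
  case 0
  show ?case unfolding projected_iterate.simps by measurable
qed

section \<open>Convergence of the algorithm and finiteness of the proper projections\<close>

theorem theorem4p1:
  fixes M :: "'p measure"
    and \<mu> :: "real ^ 'n" and r :: real
    and W :: "'p \<Rightarrow> real" and S :: "(real ^ 'n) set" and U X :: "'p \<Rightarrow> real ^ 'n"
    and rstar R\<^sub>\<mu> R\<^sub>r :: real and \<theta> \<theta>1 :: "(real ^ 'n) \<times> real"
    and K :: "((real ^ 'n) \<times> real) set"
    and \<pi> :: "(real ^ 'n) \<times> real \<Rightarrow> (real ^ 'n) \<times> real"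
    and Xs :: "nat \<Rightarrow> 'p \<Rightarrow> real ^ 'n"
    and \<gamma> :: "nat \<Rightarrow> real"
    and \<theta>hat :: "nat \<Rightarrow> 'p \<Rightarrow> (real ^ 'n) \<times> real"
  assumes dim: "CARD('n) \<ge> 2"
    and prob: "prob_space M"
    and model: "truncated_spherical_model M \<mu> r W S U X"
    and rstar: "rstar = r * (\<integral>\<omega>. W \<omega> \<partial>M)"
    and theta: "\<theta> = (\<mu>, rstar)"
    and A1: "integrable M (\<lambda>\<omega>. 1 / (norm (X \<omega> - \<mu>))\<^sup>2)"
    and A2: "integrable M (\<lambda>\<omega>. (norm (X \<omega> - \<mu>))\<^sup>2)"
    and A3: "R\<^sub>\<mu> > 0" "R\<^sub>r > 0"
      "\<exists>A. (norm (\<integral>\<omega>. U \<omega> \<partial>M))\<^sup>2 < A \<and> A < 1 \<and>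
           (SUP z\<in>cball \<mu> R\<^sub>\<mu>. ereal (lambda_max (Gamma_mat M X z)))
             < ereal ((1 - (norm (\<integral>\<omega>. U \<omega> \<partial>M))\<^sup>2 / A) / (rstar + 3/2 * R\<^sub>r))"
    and K: "compact K" "convex K" "K \<subseteq> UNIV \<times> {0<..}"
      "K \<subseteq> cball \<mu> R\<^sub>\<mu> \<times> cball rstar R\<^sub>r" "\<theta> \<in> K - frontier K"
    and proj: "\<And>y. \<pi> y \<in> K" "\<And>y. y \<in> K \<Longrightarrow> \<pi> y = y"
      "\<And>y y'. norm (\<pi> y - \<pi> y') \<le> norm (y - y')"
      "\<And>y. y \<notin> K \<Longrightarrow> \<pi> y \<in> frontier K"
    and iid: "prob_space.indep_vars M (\<lambda>_. borel) Xs {1..}"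
      "\<And>n. n \<ge> 1 \<Longrightarrow> distr M borel (Xs n) = distr M borel X"
    and step: "\<And>n. n \<ge> 1 \<Longrightarrow> \<gamma> n > 0" "\<And>m n. 1 \<le> m \<Longrightarrow> m \<le> n \<Longrightarrow> \<gamma> n \<le> \<gamma> m"
      "filterlim (\<lambda>N. \<Sum>n=1..N. \<gamma> n) at_top sequentially"
      "summable (\<lambda>n. (\<gamma> (Suc n))\<^sup>2)"
    and init: "\<theta>1 \<in> K" "\<And>\<omega>. \<omega> \<in> space M \<Longrightarrow> \<theta>hat 1 \<omega> = \<theta>1"
    and rec: "\<And>n \<omega>. n \<ge> 1 \<Longrightarrow> \<omega> \<in> space M \<Longrightarrow>
      \<theta>hat (n + 1) \<omega> = \<pi> (\<theta>hat n \<omega> - \<gamma> n *\<^sub>R grad_g (Xs (n + 1) \<omega>) (\<theta>hat n \<omega>))"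
  shows "(AE \<omega> in M. (\<lambda>n. norm (\<theta>hat n \<omega> - \<theta>)) \<longlonglongrightarrow> 0) \<and>
    (AE \<omega> in M. finite {n. n \<ge> 1 \<and>
       \<theta>hat n \<omega> - \<gamma> n *\<^sub>R grad_g (Xs (n + 1) \<omega>) (\<theta>hat n \<omega>) \<notin> K})"
proof -
  interpret prob_space M by (rule prob)
  have [measurable]: "W \<in> borel_measurable M" "U \<in> borel_measurable M"
    and X_eq: "X = (\<lambda>\<omega>. \<mu> + (r * W \<omega>) *\<^sub>R U \<omega>)"
    using model unfolding truncated_spherical_model_def by auto
  have X[measurable]: "X \<in> borel_measurable M" unfolding X_eq by measurable
  have Xs[measurable]: "Xs i \<in> borel_measurable M" if "i \<ge> 1" for i
    using iid(1) that unfolding indep_vars_def by auto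
  have \<theta>K: "\<theta> \<in> K" and \<theta>int: "\<theta> \<in> interior K"
    using K(1,5) by (auto simp: frontier_def compact_imp_closed)
  have rs: "rstar > 0" using \<theta>K K(3) theta by auto
  have \<pi>: "\<pi> \<in> borel_measurable borel"
  proof (intro borel_measurable_continuous_onI)
    have "dist (\<pi> x) (\<pi> y) \<le> 1 * dist x y" for x y using proj(3)[of x y] by (simp add: dist_norm)
    then have "1-lipschitz_on UNIV \<pi>" by (intro lipschitz_onI) auto
    then show "continuous_on UNIV \<pi>" by (rule lipschitz_on_continuous_on)
  qed
  obtain c where c: "c > 0" and coercive0:
    "\<And>y. fst y \<in> cball \<mu> R\<^sub>\<mu> \<Longrightarrow> 0 \<le> snd y \<Longrightarrow> snd y \<le> rstar + R\<^sub>r \<Longrightarrow>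
      c * (norm (y - (\<mu>, rstar)))\<^sup>2 \<le> (\<integral>\<omega>. grad_g (X \<omega>) y \<bullet> (y - (\<mu>, rstar)) \<partial>M)"
    using truncated_spherical_model_coercive[OF dim model rstar rs A1 A2 A3(2,3)] by metis
  have Kb: "fst y \<in> cball \<mu> R\<^sub>\<mu>" "0 \<le> snd y" "snd y \<le> rstar + R\<^sub>r" if "y \<in> K" for y
  proof -
    have "fst y \<in> cball \<mu> R\<^sub>\<mu>" "snd y \<in> cball rstar R\<^sub>r" "snd y > 0"
      using subsetD[OF K(3) that] subsetD[OF K(4) that] by (auto simp: mem_Times_iff)
    then show "fst y \<in> cball \<mu> R\<^sub>\<mu>" "0 \<le> snd y" "snd y \<le> rstar + R\<^sub>r" by (auto simp: dist_real_def)
  qed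
  define C where "C = 8 * (\<integral>\<omega>. (norm (X \<omega> - \<mu>))\<^sup>2 \<partial>M) + 8 * R\<^sub>\<mu>\<^sup>2 + 4 * (rstar + R\<^sub>r)\<^sup>2"
  have C: "0 \<le> C" unfolding C_def by simp
  have onestep: "(\<integral>\<omega>. (norm (\<pi> (y - g *\<^sub>R grad_g (X \<omega>) y) - \<theta>))\<^sup>2 \<partial>M)
      \<le> (norm (y - \<theta>))\<^sup>2 - 2 * g * c * (norm (y - \<theta>))\<^sup>2 + C * g\<^sup>2" if y: "y \<in> K" and g: "0 \<le> g" for y g
    unfolding C_def
  proof (rule expected_projected_step_le[OF X A2 proj(3) proj(2)[OF \<theta>K]])
    show "norm (fst y - \<mu>) \<le> R\<^sub>\<mu>" "\<bar>snd y\<bar> \<le> rstar + R\<^sub>r"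
      using Kb[OF y] by (auto simp: dist_norm norm_minus_commute)
    show "c * (norm (y - \<theta>))\<^sup>2 \<le> (\<integral>\<omega>. grad_g (X \<omega>) y \<bullet> (y - \<theta>) \<partial>M)"
      unfolding theta by (rule coercive0[OF Kb[OF y]])
  qed (rule g)
  obtain b where b: "\<And>p. p \<in> K \<Longrightarrow> norm p \<le> b"
    using compact_imp_bounded[OF K(1)] unfolding bounded_iff by auto
  \<comment> \<open>A bound for the squared error on the compact set \<open>K\<close>, which
    contains all iterates; it makes \<open>V\<close>, \<open>F\<close> and \<open>G\<close> below
    bounded.\<close>
  define D where "D = (b + norm \<theta>)\<^sup>2"
  have D: "(norm (p - \<theta>))\<^sup>2 \<le> D" if "p \<in> K" for p
    unfolding D_def
  proof (rule power_mono)
    show "norm (p - \<theta>) \<le> b + norm \<theta>" using norm_triangle_ineq4[of p \<theta>] b[OF that] by linarith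
  qed simp
  define Th where "Th = projected_iterate \<pi> \<gamma> \<theta>1"
  have ThK: "Th k x \<in> K" for k x unfolding Th_def using init(1) proj(1) by (cases k) auto
  have Thm: "Th k \<in> borel_measurable (PiM {1..n} (\<lambda>_. borel))" if "k < n" for k n
    unfolding Th_def using \<pi> that by (rule projected_iterate_measurable)
  have hat: "\<theta>hat (Suc k) \<omega> = Th k (\<lambda>i. Xs i \<omega>)" if \<omega>: "\<omega> \<in> space M" for k \<omega>
  proof (induction k)
    case 0
    then show ?case using init(2)[OF \<omega>] by (simp add: Th_def)
  next
    case (Suc k)
    then show ?case using rec[of "Suc k" \<omega>] \<omega> by (simp add: Th_def)
  qed
  \<comment> \<open>The first \<open>n\<close> observations as one point of a product space. An
    iterate \<open>Th k\<close> with \<open>k < n\<close> is a function of it.\<close>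
  define T where "T n \<omega> = restrict (\<lambda>i. Xs i \<omega>) {1..n}" for n :: nat and \<omega>
  have Tm[measurable]: "T n \<in> M \<rightarrow>\<^sub>M PiM {1..n} (\<lambda>_. borel)" for n
    unfolding T_def by (rule measurable_restrict) (use Xs in auto)
  define V where "V k \<omega> = (norm (Th k (\<lambda>i. Xs i \<omega>) - \<theta>))\<^sup>2" for k \<omega>
  have VT: "V k \<omega> = (norm (Th k (T n \<omega>) - \<theta>))\<^sup>2" if "k < n" for k n \<omega>
    unfolding V_def T_def Th_def by (simp only: projected_iterate_restrict[OF that])
  have VD: "\<bar>V k \<omega>\<bar> \<le> D" for k \<omega> unfolding V_def using D[OF ThK] by simp
  have Vm[measurable]: "V k \<in> borel_measurable M" for k
  proof -
    have [measurable]: "Th k \<in> borel_measurable (PiM {1..Suc k} (\<lambda>_. borel))" by (rule Thm) simp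
    have "(\<lambda>\<omega>. (norm (Th k (T (Suc k) \<omega>) - \<theta>))\<^sup>2) \<in> borel_measurable M" by measurable
    then show ?thesis using VT[of k "Suc k"] by (simp cong: measurable_cong)
  qed
  have Vint: "integrable M (V k)" for k
    by (rule integrable_const_bound[of _ D]) (use VD in auto)
  \<comment> \<open>\<open>V n\<close> is the squared error of iterate \<open>Suc n\<close>; the
    next one uses step size \<open>\<gamma> (Suc n)\<close> and observation
    \<open>Suc (Suc n)\<close>. The event \<open>B\<close> is determined by the observations up to
    \<open>Suc n\<close>, hence independent of the new one.\<close>
  have drift: "(\<integral>\<omega>. V (Suc n) \<omega> * indicator B \<omega> \<partial>M) + 2 * c * \<gamma> (Suc n) * (\<integral>\<omega>. V n \<omega> * indicator B \<omega> \<partial>M)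
        \<le> (\<integral>\<omega>. V n \<omega> * indicator B \<omega> \<partial>M) + C * (\<gamma> (Suc n))\<^sup>2 * prob B"
    if B: "B = {\<omega> \<in> space M. \<forall>k\<in>{m..n}. V k \<omega> < u k}" for m n u B
  proof -
    define N where "N = PiM {1..Suc n} (\<lambda>_. borel :: (real ^ 'n) measure)"
    define N' where "N' = PiM {Suc (Suc n)} (\<lambda>_. borel :: (real ^ 'n) measure)"
    define Y where "Y \<omega> = restrict (\<lambda>i. Xs i \<omega>) {Suc (Suc n)}" for \<omega>
    define g where "g = \<gamma> (Suc n)"
    have g: "0 \<le> g" using step(1)[of "Suc n"] by (simp add: g_def)
    have ind: "indep_var N (T (Suc n)) N' Y"
      unfolding N_def N'_def T_def Y_def by (rule indep_var_restrict[OF iid(1)]) auto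
    have Tn[measurable]: "T (Suc n) \<in> M \<rightarrow>\<^sub>M N" unfolding N_def by (rule Tm)
    have Thn[measurable]: "Th k \<in> borel_measurable N" if "k \<le> n" for k
      unfolding N_def by (rule Thm) (use that in simp)
    have Thn'[measurable]: "Th n \<in> borel_measurable N" by (rule Thn) simp
    \<comment> \<open>The event \<open>B\<close> transported to the space of the past, so that its
      indicator becomes a function of \<open>T (Suc n)\<close>.\<close>
    define B' where "B' = {t \<in> space N. \<forall>k\<in>{m..n}. (norm (Th k t - \<theta>))\<^sup>2 < u k}"
    have B'm[measurable]: "B' \<in> sets N"
      unfolding B'_def
    proof (rule sets.sets_Collect_finite_All)
      fix k assume "k \<in> {m..n}"
      then have [measurable]: "Th k \<in> borel_measurable N" by (intro Thn) auto
      show "{t \<in> space N. (norm (Th k t - \<theta>))\<^sup>2 < u k} \<in> sets N" by measurable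
    qed simp
    have BB': "indicator B' (T (Suc n) \<omega>) = (indicator B \<omega> :: real)" if \<omega>: "\<omega> \<in> space M" for \<omega>
    proof -
      have "T (Suc n) \<omega> \<in> space N" using measurable_space[OF Tn \<omega>] .
      then show ?thesis using \<omega> by (auto simp: B B'_def indicator_def VT[of _ "Suc n"])
    qed
    have Bm: "B \<in> events" unfolding B by measurable
    define F where "F z = (norm (\<pi> (Th n (fst z) - g *\<^sub>R grad_g (snd z (Suc (Suc n))) (Th n (fst z))) - \<theta>))\<^sup>2
        * indicator B' (fst z)" for z
    define G where "G t = ((norm (Th n t - \<theta>))\<^sup>2 - 2 * g * c * (norm (Th n t - \<theta>))\<^sup>2 + C * g\<^sup>2) * indicator B' t" for t
    have "(\<integral>\<omega>. F (T (Suc n) \<omega>, Y \<omega>) \<partial>M) \<le> (\<integral>\<omega>. G (T (Suc n) \<omega>) \<partial>M)"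
    proof (rule integral_le_of_indep_var[OF ind])
      have [measurable]: "(\<lambda>z. snd z (Suc (Suc n))) \<in> borel_measurable (N \<Otimes>\<^sub>M N')"
        unfolding N'_def by (rule measurable_compose[OF measurable_snd measurable_component_singleton]) simp
      have [measurable]: "\<pi> \<in> borel_measurable borel" by (rule \<pi>)
      show "F \<in> borel_measurable (N \<Otimes>\<^sub>M N')" unfolding F_def by measurable
      show "G \<in> borel_measurable N" unfolding G_def by measurable
      show "\<bar>F z\<bar> \<le> D" for z
        unfolding F_def using D[OF proj(1)] order_trans[OF zero_le_power2 D[OF \<theta>K]] by (auto simp: indicator_def)
      show "integrable M (\<lambda>\<omega>. G (T (Suc n) \<omega>))"
      proof (rule integrable_const_bound)
        show "AE \<omega> in M. norm (G (T (Suc n) \<omega>)) \<le> D + 2 * g * c * D + C * g\<^sup>2"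
        proof (rule AE_I2)
          fix \<omega>
          define v where "v = (norm (Th n (T (Suc n) \<omega>) - \<theta>))\<^sup>2"
          have v: "0 \<le> v" "v \<le> D" using D[OF ThK] by (auto simp: v_def)
          have "0 \<le> 2 * g * c * v" "2 * g * c * v \<le> 2 * g * c * D" "0 \<le> C * g\<^sup>2"
            using g c C v by (auto intro!: mult_left_mono)
          then have "\<bar>v - 2 * g * c * v + C * g\<^sup>2\<bar> \<le> D + 2 * g * c * D + C * g\<^sup>2" "0 \<le> D + 2 * g * c * D + C * g\<^sup>2"
            using v by linarith+
          then show "norm (G (T (Suc n) \<omega>)) \<le> D + 2 * g * c * D + C * g\<^sup>2"
            by (simp add: G_def v_def[symmetric] indicator_def)
        qed
        show "(\<lambda>\<omega>. G (T (Suc n) \<omega>)) \<in> borel_measurable M" unfolding G_def by measurable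
      qed
      fix t assume "t \<in> space N"
      let ?\<Phi> = "\<lambda>x. (norm (\<pi> (Th n t - g *\<^sub>R grad_g x (Th n t)) - \<theta>))\<^sup>2"
      have \<Phi>: "?\<Phi> \<in> borel_measurable borel" by measurable
      \<comment> \<open>With the past frozen at \<open>t\<close>, the iterate is a fixed point of
        \<open>K\<close> and the new observation has the law of \<open>X\<close>, so the one-step
        bound applies.\<close>
      have "(\<integral>\<omega>. F (t, Y \<omega>) \<partial>M) = (\<integral>\<omega>. ?\<Phi> (Xs (Suc (Suc n)) \<omega>) \<partial>M) * indicator B' t"
        by (simp add: F_def Y_def)
      also have "(\<integral>\<omega>. ?\<Phi> (Xs (Suc (Suc n)) \<omega>) \<partial>M) = (\<integral>x. ?\<Phi> x \<partial>distr M borel (Xs (Suc (Suc n))))"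
        by (rule integral_distr[symmetric]) (use \<Phi> Xs in auto)
      also have "\<dots> = (\<integral>\<omega>. ?\<Phi> (X \<omega>) \<partial>M)"
        unfolding iid(2)[of "Suc (Suc n)", simplified] by (rule integral_distr) (use \<Phi> X in auto)
      also have "\<dots> * indicator B' t \<le> G t"
        unfolding G_def by (intro mult_right_mono onestep ThK g) simp
      finally show "(\<integral>\<omega>. F (t, Y \<omega>) \<partial>M) \<le> G t" .
    qed
    also have "(\<integral>\<omega>. F (T (Suc n) \<omega>, Y \<omega>) \<partial>M) = (\<integral>\<omega>. V (Suc n) \<omega> * indicator B \<omega> \<partial>M)"
    proof (intro Bochner_Integration.integral_cong refl)
      fix \<omega> assume \<omega>: "\<omega> \<in> space M"
      have "Th n (T (Suc n) \<omega>) = Th n (\<lambda>i. Xs i \<omega>)"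
        unfolding T_def Th_def by (rule projected_iterate_restrict) simp
      then show "F (T (Suc n) \<omega>, Y \<omega>) = V (Suc n) \<omega> * indicator B \<omega>"
        by (simp add: F_def V_def BB'[OF \<omega>] Y_def g_def Th_def)
    qed
    also have "(\<integral>\<omega>. G (T (Suc n) \<omega>) \<partial>M) = (\<integral>\<omega>. (1 - 2 * g * c) * (V n \<omega> * indicator B \<omega>) + C * g\<^sup>2 * indicator B \<omega> \<partial>M)"
      by (intro Bochner_Integration.integral_cong refl)
        (simp add: G_def BB' VT[of n "Suc n"] algebra_simps)
    also have "\<dots> = (1 - 2 * g * c) * (\<integral>\<omega>. V n \<omega> * indicator B \<omega> \<partial>M) + C * g\<^sup>2 * prob B"
    proof -
      have "integrable M (\<lambda>\<omega>. V n \<omega> * indicator B \<omega>)"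
        using integrable_mult_indicator[OF Bm Vint[of n]] by (simp add: mult.commute)
      moreover have "integrable M (indicator B :: 'p \<Rightarrow> real)"
        using Bm by (intro integrable_real_indicator) (auto simp: less_top[symmetric])
      ultimately show ?thesis using sets.sets_into_space[OF Bm] by (simp add: Int_absorb2)
    qed
    finally show ?thesis by (simp add: g_def algebra_simps)
  qed
  have conv: "AE \<omega> in M. (\<lambda>n. V n \<omega>) \<longlonglongrightarrow> 0"
  proof (rule AE_tendsto_0_of_drift[where V=V and c="2 * c" and C=C and \<gamma>="\<lambda>n. \<gamma> (Suc n)", OF Vint _ _ C _ _ _ drift])
    show "0 \<le> V n \<omega>" for n \<omega> by (simp add: V_def)
    show "0 < 2 * c" using c by simp
    show "0 \<le> \<gamma> (Suc n)" for n using step(1)[of "Suc n"] by simp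
    have "(\<Sum>n=1..N. \<gamma> n) = (\<Sum>n<N. \<gamma> (Suc n))" for N
      by (simp add: sum.atLeast_Suc_atMost_Suc_shift atLeast0LessThan[symmetric] flip: sum.shift_bounds_Suc_ivl atLeastLessThanSuc_atLeastAtMost)
    then show "filterlim (\<lambda>N. \<Sum>n<N. \<gamma> (Suc n)) at_top sequentially" using step(3) by simp
    show "summable (\<lambda>n. (\<gamma> (Suc n))\<^sup>2)" by (rule step(4))
  qed
  have "AE \<omega> in M. (\<lambda>n. norm (\<theta>hat n \<omega> - \<theta>)) \<longlonglongrightarrow> 0 \<and> finite {n. n \<ge> 1 \<and>
       \<theta>hat n \<omega> - \<gamma> n *\<^sub>R grad_g (Xs (n + 1) \<omega>) (\<theta>hat n \<omega>) \<notin> K}"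
    using conv
  proof (rule AE_mp[OF _ AE_I2], intro impI)
    fix \<omega> assume \<omega>: "\<omega> \<in> space M" and lim: "(\<lambda>n. V n \<omega>) \<longlonglongrightarrow> 0"
    have "(\<lambda>n. sqrt (V n \<omega>)) \<longlonglongrightarrow> sqrt 0" using lim by (rule tendsto_real_sqrt)
    then have "(\<lambda>n. norm (\<theta>hat (Suc n) \<omega> - \<theta>)) \<longlonglongrightarrow> 0" by (simp add: V_def hat[OF \<omega>])
    then have norm0: "(\<lambda>n. norm (\<theta>hat n \<omega> - \<theta>)) \<longlonglongrightarrow> 0" by (rule LIMSEQ_imp_Suc)
    then have "(\<lambda>n. \<theta>hat n \<omega>) \<longlonglongrightarrow> \<theta>" by (simp add: tendsto_norm_zero_iff LIM_zero_iff)
    then have "eventually (\<lambda>n. \<theta>hat n \<omega> \<in> interior K) sequentially"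
      using \<theta>int by (intro topological_tendstoD) auto
    then obtain n0 where n0: "\<And>n. n \<ge> n0 \<Longrightarrow> \<theta>hat n \<omega> \<in> interior K" by (auto simp: eventually_sequentially)
    have "{n. n \<ge> 1 \<and> \<theta>hat n \<omega> - \<gamma> n *\<^sub>R grad_g (Xs (n + 1) \<omega>) (\<theta>hat n \<omega>) \<notin> K} \<subseteq> {..<n0}"
    proof (rule subsetI)
      fix n assume "n \<in> {n. n \<ge> 1 \<and> \<theta>hat n \<omega> - \<gamma> n *\<^sub>R grad_g (Xs (n + 1) \<omega>) (\<theta>hat n \<omega>) \<notin> K}"
      then have n: "n \<ge> 1" "\<theta>hat n \<omega> - \<gamma> n *\<^sub>R grad_g (Xs (n + 1) \<omega>) (\<theta>hat n \<omega>) \<notin> K"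
        by auto
      then have "\<theta>hat (n + 1) \<omega> \<in> frontier K" using proj(4) rec[OF n(1) \<omega>] by simp
      then have "\<theta>hat (n + 1) \<omega> \<notin> interior K" by (simp add: frontier_def)
      \<comment> \<open>The frontier is disjoint from the interior, which contains every iterate
        from \<open>n0\<close> on.\<close>
      then have "\<not> n0 \<le> n + 1" using n0 by blast
      then show "n \<in> {..<n0}" by simp
    qed
    then have "finite {n. n \<ge> 1 \<and> \<theta>hat n \<omega> - \<gamma> n *\<^sub>R grad_g (Xs (n + 1) \<omega>) (\<theta>hat n \<omega>) \<notin> K}"
      by (rule finite_subset) simp
    with norm0 show "(\<lambda>n. norm (\<theta>hat n \<omega> - \<theta>)) \<longlonglongrightarrow> 0 \<and> finite {n. n \<ge> 1 \<and>
       \<theta>hat n \<omega> - \<gamma> n *\<^sub>R grad_g (Xs (n + 1) \<omega>) (\<theta>hat n \<omega>) \<notin> K}" ..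
  qed
  then show ?thesis by (simp only: AE_conj_iff)
qed

end
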